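(* Consider a Nash equilibrium problem of polynomials with $N$ players, objectives $f_i\in\mathbb{R}[x]$ and constraining polynomial tuples $g_i=(g_{i,1},\ldots,g_{i,m_i})$, $g_{i,j}\in\mathbb{R}[x_i]$ (see context). Assume each $g_i$ is nonsingular, with polynomial expressions of Lagrange multipliers $\lambda_{i,j}(x)$ as in the context. Let $\mathcal{G}$ be the set of all $x\in\mathbb{R}^n$ satisfying the KKT system (K), let $\mathcal{G}^*$ be the set of all Nash equilibria, and assume $\mathcal{G}\setminus\mathcal{G}^*$ is a finite set. Let $\Theta$ be a generic positive definite matrix and let $x^*$ be a Nash equilibrium computed by Algorithm A with this $\Theta$ that is an isolated KKT point (an isolated point of $\mathcal{G}$). If there are finitely many Nash equilibria, then all of them can be found by applying Algorithm B of the context repeatedly (starting from $x^*$, each time with the most recently found Nash equilibrium as input).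
   Context: **Nash equilibrium problem (NEP) of polynomials.** There are $N$ players; player $i$ has strategy $x_i\in\mathbb{R}^{n_i}$; $x=(x_1,\ldots,x_N)\in\mathbb{R}^n$, $n=n_1+\cdots+n_N$; $x_{-i}$ is the vector of all blocks except $x_i$, and one writes $x=(x_i,x_{-i})$. $[N]=\{1,\ldots,N\}$. Player $i$ has an objective $f_i\in\mathbb{R}[x]$ and constraining polynomials $g_{i,j}\in\mathbb{R}[x_i]$, $j\in[m_i]=\mathcal{E}_i\sqcup\mathcal{I}_i$, with feasible set $X_i=\{x_i\in\mathbb{R}^{n_i}: g_{i,j}(x_i)=0\ (j\in\mathcal{E}_i),\ g_{i,j}(x_i)\ge0\ (j\in\mathcal{I}_i)\}$. A Nash equilibrium (NE) is a point $x^*$ such that for every $i$, $x_i^*$ is a (global) minimizer of $f_i(\cdot,x_{-i}^* )$ over $X_i$. **Nonsingularity and multiplier expressions.** Let $G_i(x_i)$ be the $(n_i+m_i)\times m_i$ matrix polynomial whose top $n_i$ rows are $[\nabla_{x_i}g_{i,1}(x_i)\ \cdots\ \nabla_{x_i}g_{i,m_i}(x_i)]$ and whose bottom $m_i$ rows are $\mathrm{diag}(g_{i,1}(x_i),\ldots,g_{i,m_i}(x_i))$. The tuple $g_i$ is nonsingular if $G_i(x_i)$ has full column rank for every $x_i\in\mathbb{C}^{n_i}$. In that case there is a matrix polynomial $H_i(x_i)$ with real coefficients such that $H_i(x_i)G_i(x_i)=I_{m_i}$; fix one. Let $\hat f_i(x)=(\nabla_{x_i}f_i(x),0,\ldots,0)\in\mathbb{R}^{n_i+m_i}$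 and $\lambda_{i,j}(x):=(H_i(x_i)\hat f_i(x))_j$. **System (K).** For all $i\in[N]$: $\nabla_{x_i}f_i(x)-\sum_{j=1}^{m_i}\lambda_{i,j}(x)\nabla_{x_i}g_{i,j}(x_i)=0$; $g_{i,j}(x_i)=0$ for $j\in\mathcal{E}_i$; and $\lambda_{i,j}(x)g_{i,j}(x_i)=0$, $g_{i,j}(x_i)\ge0$, $\lambda_{i,j}(x)\ge0$ for $j\in\mathcal{I}_i$. Solutions $x\in\mathbb{R}^n$ are exactly the KKT points of the NEP. **Problem (U).** For finite sets $\mathcal{K}_i\subseteq X_i$, a symmetric positive definite $\Theta\in\mathbb{R}^{(n+1)\times(n+1)}$ and $[x]_1:=(1,x^T)^T\in\mathbb{R}^{n+1}$: minimize $[x]_1^T\Theta[x]_1$ over all $x\in\mathbb{R}^n$ satisfying (K) and $f_i(v,x_{-i})-f_i(x_i,x_{-i})\ge0$ for all $v\in\mathcal{K}_i$, $i\in[N]$. **Problem (U$_\delta$)** (for a given input NE $x^*$). Minimize $[x]_1^T\Theta[x]_1$ over all $x$ feasible for (U) with $[x]_1^T\Theta[x]_1\ge[x^*]_1^T\Theta[x^*]_1+\delta$. **Problem (M$_\delta$)** (for a given input NE $x^*$). Maximize $[x]_1^T\Theta[x]_1$ over all $x$ feasible for (U) with $[x]_1^T\Theta[x]_1\le[x^*]_1^T\Theta[x^*]_1+\delta$. **Problem (L$_i(u)$).** For $u\in\mathbb{R}^n$: $\omega_i:=\min\{f_i(x_i,u_{-i})-f_i(u_i,u_{-i}): x_i\in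 X_i\}$. In both algorithms all optimization problems are solved exactly, and it is understood that each problem (L$_i(u)$) that is encountered has a minimizer. **Algorithm A.** Step 0: set $\mathcal{K}_i:=\emptyset$ for all $i$; choose a generic positive definite $\Theta$ of size $n+1$. Step 1: solve (U). If it is infeasible, output that there is no NE and stop; otherwise let $u$ be an optimizer. Step 2: solve (L$_i(u)$) for each $i$. If all $\omega_i\ge0$, output the NE $u$ and stop; otherwise go to Step 3. Step 3: for each $i$ with $\omega_i<0$, obtain a nonempty finite set $U_i$ of some (not necessarily all) optimizers of (L$_i(u)$), replace $\mathcal{K}_i$ by $\mathcal{K}_i\cup U_i$, and go to Step 1. **Algorithm B** (input: a computed NE $x^*$, with the $\Theta$ and the current sets $\mathcal{K}_i$ from its computation). Step 0: give an initial value $\delta>0$ (say $0.1$). Step 1: solve (M$_\delta$). If its optimal value $\eta$ equals $\upsilon:=[x^*]_1^T\Theta[x^*]_1$, go to Step 2. If $\eta>\upsilon$, replace $\delta$ by $\delta/5$ and repeat this step. Step 2: solve (U$_\delta$). If it is infeasible, output that there are no additional NEs and stop; otherwise let $u$ be a minimizer. Step 3: solve (L$_i(u)$) for each $i$. If all $\omega_i\ge0$, output the new NE $u$ and stop; otherwise go to Step 4. Step 4: for each $i$ with $\omega_i<0$, obtain a nonempty finite set $U_i$ of optimizers of (L$_i(u)$), replace $\mathcal{K}_i$ by $\mathcal{K}_i\cup U_i$, and go to Step 2. **Repeated application.** After Algorithm B returns a new NE $u$, it is applied again with $x^*:=u$ (same $\Theta$, current sets $\mathcal{K}_i$), and so on,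 until it reports that there are no additional NEs. **Generic $\Theta$**: the assertion holds for all symmetric positive definite $\Theta$ outside a set of Lebesgue measure zero (depending on the NEP). *)

theory Defs
  imports
    "HOL-Analysis.Analysis"
    "HOL-Library.Poly_Mapping"
    "HOL-Library.Uprod"
    "Jordan_Normal_Form.DL_Rank"
begin

section \<open>Multivariate polynomials\<close>

text \<open>A polynomial with real coefficients in the variables \<open>'v\<close> is a finitely supported map
  from exponent vectors to coefficients; multiplication is the convolution product.\<close>

type_synonym 'v rpoly = "('v \<Rightarrow>\<^sub>0 nat) \<Rightarrow>\<^sub>0 real"

definition pvars :: "'v rpoly \<Rightarrow> 'v set" where
  "pvars p = (\<Union>m\<in>Poly_Mapping.keys p. Poly_Mapping.keys m)"

definition peval :: "('v \<Rightarrow> 'a::real_field) \<Rightarrow> 'v rpoly \<Rightarrow> 'a" where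
  "peval x p = (\<Sum>m\<in>Poly_Mapping.keys p.
     of_real (Poly_Mapping.lookup p m) *
       (\<Prod>v\<in>Poly_Mapping.keys m. x v ^ Poly_Mapping.lookup m v))"

text \<open>Formal partial derivative. A monomial not containing \<open>v\<close> contributes a zero coefficient.\<close>

definition pdiff :: "'v \<Rightarrow> 'v rpoly \<Rightarrow> 'v rpoly" where
  "pdiff v p = (\<Sum>m\<in>Poly_Mapping.keys p.
     Poly_Mapping.single (m - Poly_Mapping.single v 1)
       (real (Poly_Mapping.lookup m v) * Poly_Mapping.lookup p m))"


section \<open>Nash equilibrium problems of polynomials\<close>

text \<open>The players are the elements of the finite type \<open>'p\<close>, and \<open>x = (x\<^sub>1, \<dots>, x\<^sub>N)\<close> is an element
  of \<open>real ^ 'v\<close>, where the finite type \<open>'v\<close> indexes the \<open>n = n\<^sub>1 + \<dots> + n\<^sub>N\<close> coordinates: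
  \<open>var P i k\<close> is the coordinate that holds the \<open>k\<close>-th entry of \<open>x\<^sub>i\<close>, for \<open>k < nvar P i\<close>.
  A strategy of a single player is a \<^typ>\<open>real Matrix.vec\<close> of dimension \<open>nvar P i\<close>.
  The constraining polynomials of player \<open>i\<close> are polynomials in the variables \<open>0, \<dots>, nvar P i - 1\<close>
  (the entries of \<open>x\<^sub>i\<close>) and are numbered \<open>0, \<dots>, ncon P i - 1\<close>.\<close>

record ('p, 'v) nep =
  nvar :: "'p \<Rightarrow> nat"
  var :: "'p \<Rightarrow> nat \<Rightarrow> 'v"
  obj :: "'p \<Rightarrow> 'v rpoly"
  ncon :: "'p \<Rightarrow> nat"
  con :: "'p \<Rightarrow> nat \<Rightarrow> nat rpoly"
  eqs :: "'p \<Rightarrow> nat set"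
  ineqs :: "'p \<Rightarrow> nat set"

definition is_nep :: "('p::finite, 'v::finite) nep \<Rightarrow> bool" where
  "is_nep P \<longleftrightarrow>
     bij_betw (\<lambda>(i, k). var P i k) (SIGMA i:UNIV. {..<nvar P i}) UNIV \<and>
     (\<forall>i. \<forall>j<ncon P i. pvars (con P i j) \<subseteq> {..<nvar P i}) \<and>
     (\<forall>i. eqs P i \<union> ineqs P i = {..<ncon P i} \<and> eqs P i \<inter> ineqs P i = {})"

definition block :: "('p, 'v::finite) nep \<Rightarrow> 'p \<Rightarrow> real ^ 'v \<Rightarrow> real Matrix.vec" where
  "block P i x = Matrix.vec (nvar P i) (\<lambda>k. vec_nth x (var P i k))"

text \<open>\<open>replace_block P i y x\<close> is the point \<open>(y, x\<^sub>-\<^sub>i)\<close>.\<close>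

definition replace_block ::
    "('p, 'v::finite) nep \<Rightarrow> 'p \<Rightarrow> real Matrix.vec \<Rightarrow> real ^ 'v \<Rightarrow> real ^ 'v" where
  "replace_block P i y x =
     (\<chi> w. if w \<in> var P i ` {..<nvar P i}
            then vec_index y (inv_into {..<nvar P i} (var P i) w)
            else vec_nth x w)"

definition cost :: "('p, 'v::finite) nep \<Rightarrow> 'p \<Rightarrow> real ^ 'v \<Rightarrow> real" where
  "cost P i x = peval (vec_nth x) (obj P i)"

definition feasible :: "('p, 'v) nep \<Rightarrow> 'p \<Rightarrow> real Matrix.vec set" where
  "feasible P i = {y \<in> carrier_vec (nvar P i).
     (\<forall>j\<in>eqs P i. peval (vec_index y) (con P i j) = 0) \<and>
     (\<forall>j\<in>ineqs P i. peval (vec_index y) (con P i j) \<ge> 0)}"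

definition nash_equilibrium :: "('p, 'v::finite) nep \<Rightarrow> real ^ 'v \<Rightarrow> bool" where
  "nash_equilibrium P x \<longleftrightarrow>
     (\<forall>i. is_arg_min (\<lambda>y. cost P i (replace_block P i y x)) (\<lambda>y. y \<in> feasible P i) (block P i x))"


section \<open>Lagrange multiplier expressions and the KKT system\<close>

definition G_mat :: "('p, 'v) nep \<Rightarrow> 'p \<Rightarrow> nat rpoly Matrix.mat" where
  "G_mat P i = Matrix.mat (nvar P i + ncon P i) (ncon P i)
     (\<lambda>(r, j). if r < nvar P i then pdiff r (con P i j)
               else if r - nvar P i = j then con P i j else 0)"

definition nonsingular :: "('p, 'v) nep \<Rightarrow> 'p \<Rightarrow> bool" where
  "nonsingular P i \<longleftrightarrow>
     (\<forall>z \<in> carrier_vec (nvar P i). vec_space.rank (nvar P i + ncon P i)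
        (map_mat (peval (vec_index z)) (G_mat P i) :: complex Matrix.mat) = ncon P i)"

definition multiplier_matrices ::
    "('p, 'v) nep \<Rightarrow> ('p \<Rightarrow> nat rpoly Matrix.mat) \<Rightarrow> bool" where
  "multiplier_matrices P H \<longleftrightarrow>
     (\<forall>i. H i \<in> carrier_mat (ncon P i) (nvar P i + ncon P i) \<and>
          (\<forall>p \<in> elements_mat (H i). pvars p \<subseteq> {..<nvar P i}) \<and>
          H i * G_mat P i = 1\<^sub>m (ncon P i))"

definition fhat :: "('p, 'v::finite) nep \<Rightarrow> 'p \<Rightarrow> real ^ 'v \<Rightarrow> real Matrix.vec" where
  "fhat P i x = Matrix.vec (nvar P i + ncon P i)
     (\<lambda>r. if r < nvar P i then peval (vec_nth x) (pdiff (var P i r) (obj P i)) else 0)"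

definition multiplier ::
    "('p, 'v::finite) nep \<Rightarrow> ('p \<Rightarrow> nat rpoly Matrix.mat) \<Rightarrow> 'p \<Rightarrow> nat \<Rightarrow> real ^ 'v \<Rightarrow> real" where
  "multiplier P H i j x =
     vec_index (mult_mat_vec (map_mat (peval (vec_index (block P i x))) (H i)) (fhat P i x)) j"

definition kkt ::
    "('p, 'v::finite) nep \<Rightarrow> ('p \<Rightarrow> nat rpoly Matrix.mat) \<Rightarrow> real ^ 'v \<Rightarrow> bool" where
  "kkt P H x \<longleftrightarrow> (\<forall>i.
     (\<forall>k<nvar P i. peval (vec_nth x) (pdiff (var P i k) (obj P i))
        - (\<Sum>j<ncon P i. multiplier P H i j x *
             peval (vec_index (block P i x)) (pdiff k (con P i j))) = 0) \<and>
     (\<forall>j\<in>eqs P i. peval (vec_index (block P i x)) (con P i j) = 0) \<and>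
     (\<forall>j\<in>ineqs P i.
        multiplier P H i j x * peval (vec_index (block P i x)) (con P i j) = 0 \<and>
        peval (vec_index (block P i x)) (con P i j) \<ge> 0 \<and>
        multiplier P H i j x \<ge> 0))"


section \<open>Generic positive definite matrices\<close>

definition posdef :: "real ^ 'k ^ 'k::finite \<Rightarrow> bool" where
  "posdef A \<longleftrightarrow> transpose A = A \<and> (\<forall>y. y \<noteq> 0 \<longrightarrow> y \<bullet> (A *v y) > 0)"

instance uprod :: (finite) finite
  by standard simp

text \<open>Symmetric matrices are a null set among all square matrices, so measure zero has to be taken
  in the space of symmetric matrices itself. Its coordinates are the entries indexed by unordered
  pairs of indices.\<close>

definition sym_mat :: "real ^ 'k uprod \<Rightarrow> real ^ 'k ^ 'k::finite" where
  "sym_mat t = (\<chi> a b. vec_nth t (Upair a b))"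

definition for_generic_posdef :: "(real ^ 'k ^ 'k::finite \<Rightarrow> bool) \<Rightarrow> bool" where
  "for_generic_posdef Q \<longleftrightarrow>
     (AE t in (lebesgue :: (real ^ 'k uprod) measure). posdef (sym_mat t) \<longrightarrow> Q (sym_mat t))"


section \<open>The optimization problems\<close>

text \<open>The index \<^const>\<open>None\<close> is that of the leading entry \<open>1\<close> of \<open>[x]\<^sub>1\<close>.\<close>

definition homog :: "real ^ 'v \<Rightarrow> real ^ 'v option" where
  "homog x = (\<chi> c. case c of None \<Rightarrow> 1 | Some w \<Rightarrow> vec_nth x w)"

definition quad :: "real ^ 'v option ^ 'v option \<Rightarrow> real ^ 'v::finite \<Rightarrow> real" where
  "quad \<Theta> x = homog x \<bullet> (\<Theta> *v homog x)"

type_synonym 'p cuts = "'p \<Rightarrow> real Matrix.vec set"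

definition U_feasible ::
    "('p, 'v::finite) nep \<Rightarrow> ('p \<Rightarrow> nat rpoly Matrix.mat) \<Rightarrow> 'p cuts \<Rightarrow> real ^ 'v \<Rightarrow> bool" where
  "U_feasible P H K x \<longleftrightarrow>
     kkt P H x \<and> (\<forall>i. \<forall>y\<in>K i. cost P i (replace_block P i y x) - cost P i x \<ge> 0)"

definition U\<delta>_feasible where
  "U\<delta>_feasible P H \<Theta> K xs \<delta> x \<longleftrightarrow> U_feasible P H K x \<and> quad \<Theta> x \<ge> quad \<Theta> xs + \<delta>"

definition M\<delta>_feasible where
  "M\<delta>_feasible P H \<Theta> K xs \<delta> x \<longleftrightarrow> U_feasible P H K x \<and> quad \<Theta> x \<le> quad \<Theta> xs + \<delta>"

definition L_obj ::
    "('p, 'v::finite) nep \<Rightarrow> 'p \<Rightarrow> real ^ 'v \<Rightarrow> real Matrix.vec \<Rightarrow> real" where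
  "L_obj P i u y = cost P i (replace_block P i y u) - cost P i u"

definition L_minimizer ::
    "('p, 'v::finite) nep \<Rightarrow> 'p \<Rightarrow> real ^ 'v \<Rightarrow> real Matrix.vec \<Rightarrow> bool" where
  "L_minimizer P i u y \<longleftrightarrow> is_arg_min (L_obj P i u) (\<lambda>y. y \<in> feasible P i) y"

definition L_value :: "('p, 'v::finite) nep \<Rightarrow> 'p \<Rightarrow> real ^ 'v \<Rightarrow> real \<Rightarrow> bool" where
  "L_value P i u w \<longleftrightarrow> (\<exists>y. L_minimizer P i u y \<and> w = L_obj P i u y)"

definition L_solvable :: "('p, 'v::finite) nep \<Rightarrow> real ^ 'v \<Rightarrow> bool" where
  "L_solvable P u \<longleftrightarrow> (\<forall>i. \<exists>y. L_minimizer P i u y)"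

definition accepts :: "('p, 'v::finite) nep \<Rightarrow> real ^ 'v \<Rightarrow> bool" where
  "accepts P u \<longleftrightarrow> (\<exists>\<omega>. (\<forall>i. L_value P i u (\<omega> i)) \<and> (\<forall>i. \<omega> i \<ge> 0))"

text \<open>\<open>add_cuts P u K K'\<close>: the candidate \<open>u\<close> is rejected and \<open>K'\<close> is a possible update of the
  sets \<open>K\<close>.\<close>

definition add_cuts ::
    "('p, 'v::finite) nep \<Rightarrow> real ^ 'v \<Rightarrow> 'p cuts \<Rightarrow> 'p cuts \<Rightarrow> bool" where
  "add_cuts P u K K' \<longleftrightarrow>
     (\<exists>\<omega>. (\<forall>i. L_value P i u (\<omega> i)) \<and> (\<exists>i. \<omega> i < 0) \<and>
        (\<forall>i. if \<omega> i < 0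
             then \<exists>V. finite V \<and> V \<noteq> {} \<and> (\<forall>y\<in>V. L_minimizer P i u y) \<and> K' i = K i \<union> V
             else K' i = K i))"


section \<open>The algorithms\<close>

text \<open>Both algorithms are nondeterministic transition systems: any optimizer, any nonempty finite
  sets of optimizers and any initial value of \<open>\<delta>\<close> may be chosen. A constructor records the
  step to be executed next, together with the current data. No transition leaves a step 2
  (algorithm A) or step 3 (algorithm B) with a candidate \<open>u\<close> for which some problem
  (L\<open>\<^sub>i\<close>(u)) has no minimizer.\<close>

datatype ('p, 'v) stateA =
    A1 "'p cuts"
  | A2 "'p cuts" "real ^ 'v"
  | A_no_NE
  | A_NE "'p cuts" "real ^ 'v"

inductive stepA ::
    "('p, 'v::finite) nep \<Rightarrow> ('p \<Rightarrow> nat rpoly Matrix.mat) \<Rightarrow> real ^ 'v option ^ 'v option \<Rightarrow>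
     ('p, 'v) stateA \<Rightarrow> ('p, 'v) stateA \<Rightarrow> bool"
  for P H \<Theta> where
    A_infeasible: "\<nexists>x. U_feasible P H K x \<Longrightarrow> stepA P H \<Theta> (A1 K) A_no_NE"
  | A_candidate: "is_arg_min (quad \<Theta>) (U_feasible P H K) u \<Longrightarrow> stepA P H \<Theta> (A1 K) (A2 K u)"
  | A_accept: "accepts P u \<Longrightarrow> stepA P H \<Theta> (A2 K u) (A_NE K u)"
  | A_reject: "add_cuts P u K K' \<Longrightarrow> stepA P H \<Theta> (A2 K u) (A1 K')"

definition algorithm_A_computes ::
    "('p, 'v::finite) nep \<Rightarrow> ('p \<Rightarrow> nat rpoly Matrix.mat) \<Rightarrow> real ^ 'v option ^ 'v option \<Rightarrow>
     'p cuts \<Rightarrow> real ^ 'v \<Rightarrow> bool" where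
  "algorithm_A_computes P H \<Theta> K x \<longleftrightarrow> (stepA P H \<Theta>)\<^sup>*\<^sup>* (A1 (\<lambda>_. {})) (A_NE K x)"

text \<open>In the non-initial states of algorithm B, the arguments are the current sets \<open>K\<close>, the input
  \<open>xs\<close>, the current value of \<open>\<delta>\<close> and the candidate \<open>u\<close>.\<close>

datatype ('p, 'v) stateB =
    B0 "'p cuts" "real ^ 'v"
  | B1 "'p cuts" "real ^ 'v" real
  | B2 "'p cuts" "real ^ 'v" real
  | B3 "'p cuts" "real ^ 'v" real "real ^ 'v"
  | B_no_more_NE
  | B_new_NE "'p cuts" "real ^ 'v"

inductive stepB ::
    "('p, 'v::finite) nep \<Rightarrow> ('p \<Rightarrow> nat rpoly Matrix.mat) \<Rightarrow> real ^ 'v option ^ 'v option \<Rightarrow>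
     ('p, 'v) stateB \<Rightarrow> ('p, 'v) stateB \<Rightarrow> bool"
  for P H \<Theta> where
    B_start: "\<delta> > 0 \<Longrightarrow> stepB P H \<Theta> (B0 K xs) (B1 K xs \<delta>)"
  | B_delta_ok: "is_arg_max (quad \<Theta>) (M\<delta>_feasible P H \<Theta> K xs \<delta>) y \<Longrightarrow> quad \<Theta> y = quad \<Theta> xs \<Longrightarrow>
      stepB P H \<Theta> (B1 K xs \<delta>) (B2 K xs \<delta>)"
  | B_delta_shrink: "is_arg_max (quad \<Theta>) (M\<delta>_feasible P H \<Theta> K xs \<delta>) y \<Longrightarrow> quad \<Theta> y > quad \<Theta> xs \<Longrightarrow>
      stepB P H \<Theta> (B1 K xs \<delta>) (B1 K xs (\<delta> / 5))"
  | B_infeasible: "\<nexists>x. U\<delta>_feasible P H \<Theta> K xs \<delta> x \<Longrightarrow> stepB P H \<Theta> (B2 K xs \<delta>) B_no_more_NE"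
  | B_candidate: "is_arg_min (quad \<Theta>) (U\<delta>_feasible P H \<Theta> K xs \<delta>) u \<Longrightarrow>
      stepB P H \<Theta> (B2 K xs \<delta>) (B3 K xs \<delta> u)"
  | B_accept: "accepts P u \<Longrightarrow> stepB P H \<Theta> (B3 K xs \<delta> u) (B_new_NE K u)"
  | B_reject: "add_cuts P u K K' \<Longrightarrow> stepB P H \<Theta> (B3 K xs \<delta> u) (B2 K' xs \<delta>)"

text \<open>Repeated application of algorithm B, together with the set \<open>F\<close> of the points found so far.\<close>

inductive stepB_rep ::
    "('p, 'v::finite) nep \<Rightarrow> ('p \<Rightarrow> nat rpoly Matrix.mat) \<Rightarrow> real ^ 'v option ^ 'v option \<Rightarrow>
     (real ^ 'v) set \<times> ('p, 'v) stateB \<Rightarrow> (real ^ 'v) set \<times> ('p, 'v) stateB \<Rightarrow> bool"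
  for P H \<Theta> where
    rep_step: "stepB P H \<Theta> s s' \<Longrightarrow> stepB_rep P H \<Theta> (F, s) (F, s')"
  | rep_restart: "stepB_rep P H \<Theta> (F, B_new_NE K u) (insert u F, B0 K u)"

text \<open>Starting from the equilibrium \<open>xs\<close> and the sets \<open>K\<close>, every repeated application
  terminates. Every run that cannot be continued, except for one that has met an unsolvable
  problem (L\<open>\<^sub>i\<close>(u)), has reported that there are no additional equilibria, and at that point
  the points found are exactly the Nash equilibria.\<close>

definition repeated_B_finds_all ::
    "('p, 'v::finite) nep \<Rightarrow> ('p \<Rightarrow> nat rpoly Matrix.mat) \<Rightarrow> real ^ 'v option ^ 'v option \<Rightarrow>
     'p cuts \<Rightarrow> real ^ 'v \<Rightarrow> bool" where
  "repeated_B_finds_all P H \<Theta> K xs \<longleftrightarrow>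
     (\<nexists>\<sigma>. \<sigma> 0 = ({xs}, B0 K xs) \<and> (\<forall>k::nat. stepB_rep P H \<Theta> (\<sigma> k) (\<sigma> (Suc k)))) \<and>
     (\<forall>F s. (stepB_rep P H \<Theta>)\<^sup>*\<^sup>* ({xs}, B0 K xs) (F, s) \<longrightarrow>
        (\<nexists>t. stepB_rep P H \<Theta> (F, s) t) \<longrightarrow>
        (\<forall>K' x \<delta> u. s = B3 K' x \<delta> u \<longrightarrow> L_solvable P u) \<longrightarrow>
        s = B_no_more_NE \<and> F = {x. nash_equilibrium P x})"

end

theory Submission
  imports Defs
begin

text \<open>Nash equilibria satisfy the KKT system: for a fixed player \<open>i\<close>, minimize the objective plus
  \<open>\<parallel>x - a\<parallel>\<^sup>2\<close> plus growing multiples \<open>c\<^sub>k\<close> of a quadratic penalty near the equilibrium \<open>a\<close>. The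
  stationarity conditions at the minimizers \<open>x\<^sub>k\<close> produce approximate multipliers, and the identity
  \<open>H\<^sub>i G\<^sub>i = I\<close> shows that they converge to the multiplier expressions at \<open>a\<close>. Hence the
  set of KKT points is finite. For generic \<open>\<Theta>\<close> the quadratic
  \<open>[x]\<^sub>1\<^sup>T \<Theta> [x]\<^sub>1\<close> takes distinct values on it, because every coincidence confines \<open>\<Theta>\<close> to a
  hyperplane. Algorithm B then enumerates the equilibria in increasing order of this value: after
  each return, the points found are exactly the equilibria whose value is at most the current one.\<close>

section \<open>Evaluation of polynomials\<close>

definition mono_eval :: "('v \<Rightarrow> 'a::real_field) \<Rightarrow> ('v \<Rightarrow>\<^sub>0 nat) \<Rightarrow> 'a" where
  "mono_eval x m = (\<Prod>v\<in>Poly_Mapping.keys m. x v ^ Poly_Mapping.lookup m v)"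

text \<open>Padding with exponents 0 puts two monomials on a common index set, where products can be
  compared factor by factor.\<close>

lemma mono_eval_superset:
  assumes "finite A" "Poly_Mapping.keys m \<subseteq> A"
  shows "mono_eval x m = (\<Prod>v\<in>A. x v ^ Poly_Mapping.lookup m v)"
  unfolding mono_eval_def
  by (rule prod.mono_neutral_left) (use assms in \<open>auto simp: in_keys_iff\<close>)

lemma mono_eval_zero: "mono_eval x 0 = 1"
  by (simp add: mono_eval_def)

lemma mono_eval_add: "mono_eval x (m + n) = mono_eval x m * mono_eval x n"
proof -
  let ?A = "Poly_Mapping.keys m \<union> Poly_Mapping.keys n"
  have "mono_eval x (m + n) = (\<Prod>v\<in>?A. x v ^ Poly_Mapping.lookup (m + n) v)"
    by (rule mono_eval_superset) (auto dest: set_mp[OF Poly_Mapping.keys_add])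
  also have "\<dots> = mono_eval x m * mono_eval x n"
    by (simp add: mono_eval_superset[of ?A] lookup_add power_add prod.distrib)
  finally show ?thesis .
qed

lemma peval_mono_eval:
  "peval x p = (\<Sum>m\<in>Poly_Mapping.keys p. of_real (Poly_Mapping.lookup p m) * mono_eval x m)"
  by (simp add: peval_def mono_eval_def)

lemma peval_superset:
  assumes "finite A" "Poly_Mapping.keys p \<subseteq> A"
  shows "peval x p = (\<Sum>m\<in>A. of_real (Poly_Mapping.lookup p m) * mono_eval x m)"
  unfolding peval_mono_eval
  by (rule sum.mono_neutral_left) (use assms in \<open>auto simp: in_keys_iff\<close>)

lemma peval_zero [simp]: "peval x 0 = 0"
  by (simp add: peval_def)

lemma peval_single: "peval x (Poly_Mapping.single m c) = of_real c * mono_eval x m"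
  by (simp add: peval_mono_eval)

lemma peval_one [simp]: "peval x 1 = 1"
  using peval_single[of x 0 1] by (simp add: mono_eval_zero)

lemma peval_add: "peval x (p + q) = peval x p + peval x q"
proof -
  let ?A = "Poly_Mapping.keys p \<union> Poly_Mapping.keys q"
  have "peval x (p + q) = (\<Sum>m\<in>?A. of_real (Poly_Mapping.lookup (p + q) m) * mono_eval x m)"
    by (rule peval_superset) (auto dest: set_mp[OF Poly_Mapping.keys_add])
  also have "\<dots> = peval x p + peval x q"
    by (simp add: peval_superset[of ?A] lookup_add algebra_simps sum.distrib)
  finally show ?thesis .
qed

lemma peval_sum: "peval x (\<Sum>i\<in>I. p i) = (\<Sum>i\<in>I. peval x (p i))"
  by (induction I rule: infinite_finite_induct) (auto simp: peval_add)

lemma poly_mapping_sum_single: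
  "(\<Sum>m\<in>Poly_Mapping.keys p. Poly_Mapping.single m (Poly_Mapping.lookup p m)) = p"
  by (rule poly_mapping_eqI) (simp add: lookup_sum lookup_single when_def in_keys_iff)

lemma peval_mult: "peval x (p * q) = peval x p * peval x q"
proof -
  have "p * q = (\<Sum>m\<in>Poly_Mapping.keys p. Poly_Mapping.single m (Poly_Mapping.lookup p m)) *
      (\<Sum>m\<in>Poly_Mapping.keys q. Poly_Mapping.single m (Poly_Mapping.lookup q m))"
    by (simp only: poly_mapping_sum_single)
  also have "\<dots> = (\<Sum>m\<in>Poly_Mapping.keys p. \<Sum>n\<in>Poly_Mapping.keys q.
      Poly_Mapping.single (m + n) (Poly_Mapping.lookup p m * Poly_Mapping.lookup q n))"
    by (simp add: sum_product mult_single)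
  finally show ?thesis
    by (simp add: peval_sum peval_single mono_eval_add peval_mono_eval[of x p]
        peval_mono_eval[of x q] sum_product mult_ac)
qed

lemma tendsto_peval [tendsto_intros]:
  fixes f :: "'b \<Rightarrow> 'v \<Rightarrow> real"
  assumes "\<And>v. ((\<lambda>a. f a v) \<longlongrightarrow> l v) F"
  shows "((\<lambda>a. peval (f a) p) \<longlongrightarrow> peval l p) F"
  unfolding peval_def by (intro tendsto_intros assms)

text \<open>The truncated subtraction in the exponent is harmless: it truncates only where the
  factor \<open>lookup m v\<close> is 0.\<close>

lemma mono_eval_has_derivative:
  fixes x :: "'v \<Rightarrow> real"
  shows "((\<lambda>t. mono_eval (x(v := x v + t)) m) has_real_derivative
    real (Poly_Mapping.lookup m v) * mono_eval x (m - Poly_Mapping.single v 1)) (at 0)"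
proof (cases "v \<in> Poly_Mapping.keys m")
  case False
  then have "mono_eval (x(v := x v + t)) m = mono_eval x m" for t
    unfolding mono_eval_def by (intro prod.cong) auto
  with False show ?thesis
    by (simp add: in_keys_iff)
next
  case True
  let ?A = "Poly_Mapping.keys m" and ?n = "Poly_Mapping.lookup m v"
  let ?r = "\<Prod>w\<in>?A - {v}. x w ^ Poly_Mapping.lookup m w"
  have eq: "mono_eval (x(v := x v + t)) m = (x v + t) ^ ?n * ?r" for t
    unfolding mono_eval_def by (subst prod.remove[OF _ True]) auto
  have "Poly_Mapping.keys (m - Poly_Mapping.single v 1) \<subseteq> ?A"
    by (auto simp: in_keys_iff lookup_minus)
  then have "mono_eval x (m - Poly_Mapping.single v 1) =
      (\<Prod>w\<in>?A. x w ^ Poly_Mapping.lookup (m - Poly_Mapping.single v 1) w)"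
    by (rule mono_eval_superset[rotated]) simp
  also have "\<dots> = x v ^ (?n - 1) * ?r"
    by (subst prod.remove[OF _ True]) (auto simp: lookup_minus lookup_single when_def intro!: prod.cong)
  finally show ?thesis
    unfolding eq by (auto intro!: derivative_eq_intros)
qed

lemma peval_has_derivative:
  fixes x :: "'v \<Rightarrow> real"
  shows "((\<lambda>t. peval (x(v := x v + t)) p) has_real_derivative peval x (pdiff v p)) (at 0)"
  unfolding peval_mono_eval[of _ p] pdiff_def peval_sum peval_single
  by (rule DERIV_sum) (auto intro!: derivative_eq_intros mono_eval_has_derivative)

section \<open>Penalty functions\<close>

text \<open>The term \<open>(norm (x - a))\<^sup>2\<close> makes \<open>a\<close> a strict
  minimizer. A limit point \<open>l\<close> of the penalized minimizers has zero penalty, whence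
  \<open>f a \<le> f l\<close>, while comparison with the value at \<open>a\<close> gives
  \<open>f l + (norm (l - a))\<^sup>2 \<le> f a\<close>; so \<open>l = a\<close>.\<close>

lemma penalty_sequence:
  fixes f pen :: "'a::euclidean_space \<Rightarrow> real"
  assumes S: "closed S" "a \<in> S"
    and f: "continuous_on UNIV f" and pen: "continuous_on UNIV pen"
    and pen_nonneg: "\<And>x. pen x \<ge> 0" and pen_a: "pen a = 0"
    and min: "\<And>x. x \<in> S \<Longrightarrow> pen x = 0 \<Longrightarrow> f a \<le> f x"
  obtains x c where "\<And>k::nat. x k \<in> S \<inter> ball a 1" "\<And>k. c k \<ge> (0::real)"
    "\<And>k y. y \<in> S \<inter> ball a 1 \<Longrightarrow>
       f (x k) + (norm (x k - a))\<^sup>2 + c k * pen (x k) \<le> f y + (norm (y - a))\<^sup>2 + c k * pen y"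
    "x \<longlonglongrightarrow> a" "(\<lambda>k. c k * pen (x k)) \<longlonglongrightarrow> 0"
proof -
  let ?C = "S \<inter> cball a 1"
  let ?F = "\<lambda>k x. f x + (norm (x - a))\<^sup>2 + real k * pen x"
  have C: "compact ?C" "a \<in> ?C"
    using S by (auto intro: closed_Int_compact)
  then have ne: "?C \<noteq> {}"
    by blast
  have "\<exists>z\<in>?C. \<forall>y\<in>?C. ?F k z \<le> ?F k y" for k
  proof (rule continuous_attains_inf[OF C(1) ne])
    show "continuous_on ?C (?F k)"
      by (intro continuous_intros continuous_on_subset[OF f] continuous_on_subset[OF pen]) auto
  qed
  then obtain z where z: "\<And>k. z k \<in> ?C" "\<And>k y. y \<in> ?C \<Longrightarrow> ?F k (z k) \<le> ?F k y"
    by metis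
  obtain l r where l: "l \<in> ?C" and r: "strict_mono (r :: nat \<Rightarrow> nat)" and lim: "(z \<circ> r) \<longlonglongrightarrow> l"
    using C(1) z(1) unfolding compact_def by blast
  \<comment> \<open>The minimum of \<open>f\<close> bounds \<open>k * pen (z k)\<close> by the
    constant \<open>f a - f b\<close>, which forces the penalty to 0.\<close>
  obtain b where b: "b \<in> ?C" "\<And>y. y \<in> ?C \<Longrightarrow> f b \<le> f y"
    using continuous_attains_inf[OF C(1) ne continuous_on_subset[OF f subset_UNIV]] by blast
  have tf: "(\<lambda>k. f (z (r k))) \<longlonglongrightarrow> f l" and tp: "(\<lambda>k. pen (z (r k))) \<longlonglongrightarrow> pen l"
    using f pen lim by (auto simp: continuous_on_eq_continuous_at o_def
        intro: isCont_tendsto_compose)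
  have le: "f (z k) + (norm (z k - a))\<^sup>2 + real k * pen (z k) \<le> f a" for k
    using z(2)[OF C(2), of k] pen_a by simp
  have rinf: "filterlim (\<lambda>k. real (r k)) at_top sequentially"
    by (intro filterlim_compose[OF filterlim_real_sequentially] filterlim_subseq r)
  have pen_l: "pen l = 0"
  proof (rule LIMSEQ_unique[OF tp], rule tendsto_sandwich[of "\<lambda>_. 0"])
    show "\<forall>\<^sub>F k in sequentially. pen (z (r k)) \<le> (f a - f b) / real (r k)"
      using filterlim_at_top_dense[THEN iffD1, OF rinf, rule_format, of 0]
    proof eventually_elim
      case (elim k)
      have "real (r k) * pen (z (r k)) \<le> f a - f b"
        using le[of "r k"] b(2)[OF z(1)[of "r k"]] zero_le_power2[of "norm (z (r k) - a)"] by linarith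
      with elim show ?case
        by (simp add: field_simps)
    qed
    show "(\<lambda>k. (f a - f b) / real (r k)) \<longlonglongrightarrow> 0"
      by (rule tendsto_divide_0[OF tendsto_const filterlim_at_top_imp_at_infinity[OF rinf]])
  qed (auto simp: pen_nonneg)
  have fal: "f a \<le> f l"
    using l by (intro min pen_l) auto
  have "(\<lambda>k. f (z (r k)) + (norm (z (r k) - a))\<^sup>2) \<longlonglongrightarrow> f l + (norm (l - a))\<^sup>2"
    using lim by (intro tendsto_intros tf) (simp add: o_def)
  moreover have "f (z k) + (norm (z k - a))\<^sup>2 \<le> f a" for k
    using le[of k] pen_nonneg[of "z k"] mult_nonneg_nonneg[of "real k" "pen (z k)"] by linarith
  ultimately have "f l + (norm (l - a))\<^sup>2 \<le> f a"
    by (intro LIMSEQ_le_const2) auto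
  with fal have "l = a"
    by (smt (verit) norm_eq_zero power2_less_eq_zero_iff right_minus_eq)
  have lim_pen: "(\<lambda>k. real (r k) * pen (z (r k))) \<longlonglongrightarrow> 0"
  proof (rule tendsto_sandwich[of "\<lambda>_. 0"])
    show "(\<lambda>k. f a - f (z (r k))) \<longlonglongrightarrow> 0"
      using tendsto_diff[OF tendsto_const[of "f a"] tf] by (simp add: \<open>l = a\<close>)
    show "\<forall>\<^sub>F k in sequentially. real (r k) * pen (z (r k)) \<le> f a - f (z (r k))"
      using le by (intro always_eventually allI) (smt (verit) zero_le_power2)
  qed (auto simp: pen_nonneg)
  \<comment> \<open>Passing to the open ball keeps its boundary from interfering with first-order
    conditions at the minimizers.\<close>
  have "\<forall>\<^sub>F k in sequentially. (z \<circ> r) k \<in> ball a 1"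
    using lim unfolding \<open>l = a\<close> by (rule topological_tendstoD) auto
  then obtain m where m: "\<And>k. k \<ge> m \<Longrightarrow> z (r k) \<in> ball a 1"
    by (auto simp: eventually_sequentially)
  show ?thesis
  proof (rule that[of "\<lambda>k. z (r (k + m))" "\<lambda>k. real (r (k + m))"])
    show "z (r (k + m)) \<in> S \<inter> ball a 1" for k
      using z(1)[of "r (k + m)"] m[of "k + m"] by auto
    show "(\<lambda>k. z (r (k + m))) \<longlonglongrightarrow> a"
      using LIMSEQ_ignore_initial_segment[OF lim, of m] by (simp add: \<open>l = a\<close> o_def)
    show "(\<lambda>k. real (r (k + m)) * pen (z (r (k + m)))) \<longlonglongrightarrow> 0"
      using LIMSEQ_ignore_initial_segment[OF lim_pen, of m] by simp
    show "f (z (r (k + m))) + (norm (z (r (k + m)) - a))\<^sup>2 + real (r (k + m)) * pen (z (r (k + m)))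
        \<le> f y + (norm (y - a))\<^sup>2 + real (r (k + m)) * pen y" if "y \<in> S \<inter> ball a 1" for k y
      using that by (intro z(2)) auto
  qed simp
qed

text \<open>Squaring removes the kink of \<open>min t 0\<close>, so that inequality constraints can
  be penalized differentiably; at 0 the difference quotient is at most \<open>\<bar>h\<bar>\<close>
  in absolute value.\<close>

lemma DERIV_min_zero_squared:
  "((\<lambda>t. (min t 0)\<^sup>2) has_real_derivative 2 * min t 0) (at t)"
proof -
  consider "t < 0" | "t > 0" | "t = 0" by linarith
  then show ?thesis
  proof cases
    case 1
    then have ev: "\<forall>\<^sub>F s in nhds t. (min s 0)\<^sup>2 = s\<^sup>2"
      by (intro eventually_mono[OF eventually_nhds_in_open[of "{..<0}"]]) auto
    have "((\<lambda>s. s\<^sup>2) has_real_derivative 2 * min t 0) (at t)"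
      using 1 by (auto intro!: derivative_eq_intros)
    then show ?thesis
      using DERIV_cong_ev[OF refl ev refl] by blast
  next
    case 2
    then have ev: "\<forall>\<^sub>F s in nhds t. (min s 0)\<^sup>2 = 0"
      by (intro eventually_mono[OF eventually_nhds_in_open[of "{0<..}"]]) auto
    have "((\<lambda>s. 0) has_real_derivative 2 * min t 0) (at t)"
      using 2 by (auto intro!: derivative_eq_intros)
    then show ?thesis
      using DERIV_cong_ev[OF refl ev refl] by blast
  next
    case 3
    have "(\<lambda>h. (min h 0)\<^sup>2 / h) \<midarrow>0\<rightarrow> (0::real)"
    proof (rule Lim_null_comparison)
      show "\<forall>\<^sub>F h in at (0::real). norm ((min h 0)\<^sup>2 / h) \<le> \<bar>h\<bar>"
        by (auto simp: power2_eq_square min_def)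
      show "((\<lambda>h. \<bar>h\<bar>) \<longlongrightarrow> 0) (at (0::real))"
        by (rule tendsto_rabs_zero) simp
    qed
    then show ?thesis
      using 3 by (simp add: DERIV_def)
  qed
qed

section \<open>Nash equilibria are KKT points\<close>

lemma var_eq_iff:
  assumes "is_nep P" "k < nvar P i" "k' < nvar P i'"
  shows "var P i k = var P i' k' \<longleftrightarrow> i = i' \<and> k = k'"
proof -
  have "inj_on (\<lambda>(i, k). var P i k) (SIGMA i:UNIV. {..<nvar P i})"
    using assms(1) by (auto simp: is_nep_def bij_betw_def)
  from inj_on_eq_iff[OF this, of "(i, k)" "(i', k')"] assms(2,3) show ?thesis
    by auto
qed

lemma inj_on_var: "is_nep P \<Longrightarrow> inj_on (var P i) {..<nvar P i}"
  by (auto simp: inj_on_def var_eq_iff)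

lemma block_carrier [simp]: "block P i x \<in> carrier_vec (nvar P i)"
  by (simp add: block_def)

lemma block_index [simp]: "k < nvar P i \<Longrightarrow> vec_index (block P i x) k = vec_nth x (var P i k)"
  by (simp add: block_def)

lemma replace_block_eqI:
  assumes "is_nep P" "\<And>w. w \<notin> var P i ` {..<nvar P i} \<Longrightarrow> vec_nth x w = vec_nth y w"
  shows "replace_block P i (block P i x) y = x"
  using assms by (auto simp: replace_block_def Finite_Cartesian_Product.vec_eq_iff inv_into_f_f[OF inj_on_var])

text \<open>Beyond the dimension, an entry of a vector is a default value determined by dimension
  and index alone. Hence the block depends continuously on \<open>x\<close> as a function on all of
  \<open>nat\<close>, whichever variables a polynomial evaluated there contains.\<close>

lemma vec_index_block_eq:
  "vec_index (block P i x) k =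
    (if k < nvar P i then vec_nth x (var P i k) else vec_index (block P i 0) k)"
  unfolding block_def by transfer (auto simp: mk_vec_def)

lemma vec_nth_add_axis:
  "vec_nth (x + t *\<^sub>R axis w 1) = (vec_nth x)(w := vec_nth x w + t)"
  by (auto simp: axis_def)

text \<open>An equality of whole functions, in the shape to which
  \<open>peval_has_derivative\<close> applies.\<close>

lemma vec_index_block_add_axis:
  assumes "is_nep P" "k < nvar P i"
  shows "vec_index (block P i (x + t *\<^sub>R axis (var P i k) 1)) =
    (vec_index (block P i x))(k := vec_index (block P i x) k + t)"
  using assms
  by (intro ext) (auto simp: vec_index_block_eq[of P i "x + _"] vec_index_block_eq[of P i x]
      axis_def var_eq_iff)

lemma tendsto_vec_index_block [tendsto_intros]:
  assumes "(f \<longlongrightarrow> l) F"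
  shows "((\<lambda>a. vec_index (block P i (f a)) k) \<longlongrightarrow> vec_index (block P i l) k) F"
  unfolding vec_index_block_eq[of P i "f _"] vec_index_block_eq[of P i l]
  using assms by (auto intro!: tendsto_intros)

lemma continuous_on_peval_block:
  "continuous_on A (\<lambda>x. peval (vec_index (block P i x)) p)"
  unfolding continuous_on_def by (intro ballI tendsto_intros)

lemma continuous_on_cost: "continuous_on A (cost P i)"
  unfolding continuous_on_def cost_def by (intro ballI tendsto_intros)

text \<open>The identity holds between polynomials, so it can be evaluated at any point, including
  the infeasible points that the penalty method produces.\<close>

lemma multiplier_matrix_left_inverse:
  assumes "multiplier_matrices P H" "l < ncon P i" "j < ncon P i"
  shows "(\<Sum>r<nvar P i + ncon P i. peval z (H i $$ (l, r)) * peval z (G_mat P i $$ (r, j))) =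
    (if l = j then 1 else (0::real))"
proof -
  have H: "H i \<in> carrier_mat (ncon P i) (nvar P i + ncon P i)" "H i * G_mat P i = 1\<^sub>m (ncon P i)"
    using assms(1) by (auto simp: multiplier_matrices_def)
  have G: "G_mat P i \<in> carrier_mat (nvar P i + ncon P i) (ncon P i)"
    by (simp add: G_mat_def)
  have "(H i * G_mat P i) $$ (l, j) =
      (\<Sum>r<nvar P i + ncon P i. H i $$ (l, r) * G_mat P i $$ (r, j))"
    using H(1) G assms(2,3) by (auto simp: scalar_prod_def lessThan_atLeast0 intro!: sum.cong)
  then have "peval z ((1\<^sub>m (ncon P i) :: nat rpoly Matrix.mat) $$ (l, j)) =
      (\<Sum>r<nvar P i + ncon P i. peval z (H i $$ (l, r)) * peval z (G_mat P i $$ (r, j)))"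
    by (simp add: H(2) peval_sum peval_mult)
  with assms(2,3) show ?thesis
    by auto
qed

lemma multiplier_eq_sum:
  assumes "multiplier_matrices P H" "l < ncon P i"
  shows "multiplier P H i l x =
    (\<Sum>r<nvar P i + ncon P i. peval (vec_index (block P i x)) (H i $$ (l, r)) *
       (if r < nvar P i then peval (vec_nth x) (pdiff (var P i r) (obj P i)) else 0))"
proof -
  have H: "H i \<in> carrier_mat (ncon P i) (nvar P i + ncon P i)"
    using assms(1) by (auto simp: multiplier_matrices_def)
  then show ?thesis
    using assms(2)
    by (auto simp: multiplier_def fhat_def scalar_prod_def lessThan_atLeast0 intro!: sum.cong)
qed

text \<open>Convergence of the approximate multipliers follows from continuity: they are the values
  of \<open>H i\<close> applied to vectors that tend to \<open>fhat P i a\<close>.\<close>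

lemma nash_equilibrium_imp_kkt:
  fixes P :: "('p::finite, 'v::finite) nep"
  assumes nep: "is_nep P" and H: "multiplier_matrices P H" and ne: "nash_equilibrium P a"
  shows "kkt P H a"
  unfolding kkt_def
proof (rule allI)
  fix i
  let ?n = "nvar P i" and ?m = "ncon P i"
  \<comment> \<open>Freezing the coordinates of the other players turns the problem of player
    \<open>i\<close> into one on an affine subspace of \<open>real ^ 'v\<close>, where calculus is
    available.\<close>
  define S where "S = {x. \<forall>w. w \<notin> var P i ` {..<?n} \<longrightarrow> vec_nth x w = vec_nth a w}"
  define g where "g j x = peval (vec_index (block P i x)) (con P i j)" for j x
  define dg where "dg r j x = peval (vec_index (block P i x)) (pdiff r (con P i j))" for r j x
  define df where "df r x = peval (vec_nth x) (pdiff (var P i r) (obj P i))" for r and x :: "real ^ 'v"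
  \<comment> \<open>The violation of constraint \<open>j\<close>, which for \<open>j < ?m\<close>
    vanishes exactly when the constraint holds.\<close>
  define h where "h j x = (if j \<in> eqs P i then g j x else min (g j x) 0)" for j x
  define pen where "pen x = (\<Sum>j<?m. (h j x)\<^sup>2)" for x
  have con_ix: "eqs P i \<union> ineqs P i = {..<?m}" "eqs P i \<inter> ineqs P i = {}"
    using nep by (auto simp: is_nep_def)
  have feas: "block P i x \<in> feasible P i \<longleftrightarrow> pen x = 0" for x
  proof -
    have min0: "min y 0 = 0 \<longleftrightarrow> 0 \<le> y" for y :: real
      by auto
    have "pen x = 0 \<longleftrightarrow> (\<forall>j\<in>eqs P i \<union> ineqs P i. h j x = 0)"
      unfolding con_ix(1) pen_def by (subst sum_nonneg_eq_0_iff) auto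
    also have "\<dots> \<longleftrightarrow> block P i x \<in> feasible P i"
      using con_ix(2) min0 by (auto simp: feasible_def h_def g_def)
    finally show ?thesis by simp
  qed
  have self: "replace_block P i (block P i x) a = x" if "x \<in> S" for x
    using that by (intro replace_block_eqI[OF nep]) (auto simp: S_def)
  have "a \<in> S"
    by (simp add: S_def)
  have a: "block P i a \<in> feasible P i"
    "\<And>y. y \<in> feasible P i \<Longrightarrow> cost P i a \<le> cost P i (replace_block P i y a)"
    using ne[unfolded nash_equilibrium_def is_arg_min_linorder, rule_format, of i]
    unfolding self[OF \<open>a \<in> S\<close>] by auto
  have g_cont: "continuous_on A (g j)" for A j
    unfolding g_def by (rule continuous_on_peval_block)
  obtain x c where x: "\<And>k::nat. x k \<in> S \<inter> ball a 1" and c: "\<And>k. c k \<ge> (0::real)"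
    and min: "\<And>k y. y \<in> S \<inter> ball a 1 \<Longrightarrow>
      cost P i (x k) + (norm (x k - a))\<^sup>2 + c k * pen (x k)
      \<le> cost P i y + (norm (y - a))\<^sup>2 + c k * pen y"
    and lim: "x \<longlonglongrightarrow> a" and lim_pen: "(\<lambda>k. c k * pen (x k)) \<longlonglongrightarrow> 0"
  proof (rule penalty_sequence)
    have "S = (\<Inter>w\<in>- var P i ` {..<?n}. {x. vec_nth x w = vec_nth a w})"
      by (auto simp: S_def)
    then show "closed S"
      by (auto intro!: closed_INT closed_Collect_eq continuous_intros)
    show "continuous_on UNIV (cost P i)"
      by (rule continuous_on_cost)
    have "continuous_on UNIV (h j)" for j
      by (cases "j \<in> eqs P i") (auto simp: h_def intro!: continuous_intros g_cont)
    then show "continuous_on UNIV pen"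
      unfolding pen_def by (intro continuous_intros)
    show "cost P i a \<le> cost P i y" if "y \<in> S" "pen y = 0" for y
      using a(2)[of "block P i y"] that self feas by simp
  qed (use a(1) \<open>a \<in> S\<close> feas in \<open>auto simp: pen_def sum_nonneg\<close>)
  \<comment> \<open>Up to sign, the coefficient of the gradient of \<open>g j\<close> in the
    derivative of the penalty term. It is nonnegative for inequalities, where \<open>h j\<close> is
    at most 0.\<close>
  define lam where "lam k j = - 2 * c k * h j (x k)" for k j
  have stationary: "(\<Sum>j<?m. dg r j (x k) * lam k j) =
      df r (x k) + 2 * vec_nth (x k - a) (var P i r)" if r: "r < ?n" for r k
  proof -
    let ?e = "axis (var P i r) 1" and ?X = "x k"
    let ?\<psi> = "\<lambda>t. cost P i (?X + t *\<^sub>R ?e) + (norm (?X + t *\<^sub>R ?e - a))\<^sup>2 + c k * pen (?X + t *\<^sub>R ?e)"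
    have dcost: "((\<lambda>t. cost P i (?X + t *\<^sub>R ?e)) has_real_derivative df r ?X) (at 0)"
      unfolding cost_def df_def vec_nth_add_axis by (rule peval_has_derivative)
    have "(norm (?X + t *\<^sub>R ?e - a))\<^sup>2 =
        (norm (?X - a))\<^sup>2 + 2 * t * vec_nth (?X - a) (var P i r) + t\<^sup>2" for t
    proof -
      have "?X + t *\<^sub>R ?e - a = (?X - a) + t *\<^sub>R ?e" by simp
      then show ?thesis
        by (simp only: power2_norm_eq_inner inner_add_left inner_add_right inner_scaleR_left
            inner_scaleR_right inner_axis inner_axis') (simp add: power2_eq_square distrib_left)
    qed
    then have dnorm: "((\<lambda>t. (norm (?X + t *\<^sub>R ?e - a))\<^sup>2) has_real_derivative
        2 * vec_nth (?X - a) (var P i r)) (at 0)"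
      by (auto intro!: derivative_eq_intros)
    have dg': "((\<lambda>t. g j (?X + t *\<^sub>R ?e)) has_real_derivative dg r j ?X) (at 0)" for j
      unfolding g_def dg_def vec_index_block_add_axis[OF nep r] by (rule peval_has_derivative)
    have "((\<lambda>t. (h j (?X + t *\<^sub>R ?e))\<^sup>2) has_real_derivative 2 * h j ?X * dg r j ?X) (at 0)" for j
    proof (cases "j \<in> eqs P i")
      case True
      then show ?thesis
        using dg'[of j] by (auto simp: h_def intro!: derivative_eq_intros)
    next
      case False
      have "((\<lambda>s. (min s 0)\<^sup>2) has_real_derivative 2 * min (g j ?X) 0) (at (g j (?X + 0 *\<^sub>R ?e)))"
        using DERIV_min_zero_squared[of "g j ?X"] by simp
      from DERIV_chain2[OF this dg'] False show ?thesis
        by (simp add: h_def)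
    qed
    then have dpen: "((\<lambda>t. pen (?X + t *\<^sub>R ?e)) has_real_derivative
        (\<Sum>j<?m. 2 * h j ?X * dg r j ?X)) (at 0)"
      unfolding pen_def by (rule DERIV_sum)
    have "(?\<psi> has_real_derivative df r ?X + 2 * vec_nth (?X - a) (var P i r) +
        c k * (\<Sum>j<?m. 2 * h j ?X * dg r j ?X)) (at 0)"
      by (intro DERIV_add DERIV_cmult dcost dnorm dpen)
    \<comment> \<open>This radius keeps the perturbed point in \<open>ball a 1\<close>, where the
      minimality of \<open>x k\<close> applies.\<close>
    moreover have "\<forall>t. \<bar>0 - t\<bar> < 1 - dist a ?X \<longrightarrow> ?\<psi> 0 \<le> ?\<psi> t"
    proof (intro allI impI)
      fix t :: real assume t: "\<bar>0 - t\<bar> < 1 - dist a ?X"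
      have "?X + t *\<^sub>R ?e \<in> S"
        using x[of k] r by (auto simp: S_def axis_def)
      moreover have "dist a (?X + t *\<^sub>R ?e) \<le> dist a ?X + dist ?X (?X + t *\<^sub>R ?e)"
        by (rule dist_triangle)
      with t have "?X + t *\<^sub>R ?e \<in> ball a 1"
        by (simp add: dist_norm)
      ultimately show "?\<psi> 0 \<le> ?\<psi> t"
        using min[of "?X + t *\<^sub>R ?e" k] by simp
    qed
    moreover have "0 < 1 - dist a ?X"
      using x[of k] by simp
    ultimately have "df r ?X + 2 * vec_nth (?X - a) (var P i r) +
        c k * (\<Sum>j<?m. 2 * h j ?X * dg r j ?X) = 0"
      by (blast intro: DERIV_local_min)
    moreover have "(\<Sum>j<?m. dg r j ?X * lam k j) = - (c k * (\<Sum>j<?m. 2 * h j ?X * dg r j ?X))"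
      by (simp add: lam_def sum_distrib_left sum_negf[symmetric] mult_ac)
    ultimately show ?thesis by simp
  qed
  \<comment> \<open>Since \<open>h j\<close> is either \<open>g j\<close> or 0, the product of the
    two is the square of \<open>h j\<close>, which the vanishing penalty term controls.\<close>
  have lim_g_lam: "(\<lambda>k. g j (x k) * lam k j) \<longlonglongrightarrow> 0" if j: "j < ?m" for j
  proof (rule Lim_null_comparison)
    have "norm (g j (x k) * lam k j) \<le> 2 * (c k * pen (x k))" for k
    proof -
      have "g j (x k) * h j (x k) = (h j (x k))\<^sup>2"
        by (auto simp: h_def min_def power2_eq_square)
      then have "norm (g j (x k) * lam k j) = 2 * (c k * (h j (x k))\<^sup>2)"
        using c[of k] by (simp add: lam_def abs_mult mult_ac)
      also have "\<dots> \<le> 2 * (c k * pen (x k))"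
        unfolding pen_def using j c[of k]
        by (intro mult_left_mono member_le_sum) auto
      finally show ?thesis .
    qed
    then show "\<forall>\<^sub>F k in sequentially. norm (g j (x k) * lam k j) \<le> 2 * (c k * pen (x k))"
      by simp
    show "(\<lambda>k. 2 * (c k * pen (x k))) \<longlonglongrightarrow> 0"
      using tendsto_mult[OF tendsto_const[of 2] lim_pen] by simp
  qed
  \<comment> \<open>This is the evaluated matrix \<open>G_mat P i\<close> times the vector
    \<open>lam k\<close>: stationarity rewrites the gradient rows, the diagonal rows are read off.
    Multiplying by \<open>H i\<close> therefore recovers \<open>lam k\<close>.\<close>
  define W where "W k r = (if r < ?n then df r (x k) + 2 * vec_nth (x k - a) (var P i r)
      else g (r - ?n) (x k) * lam k (r - ?n))" for k r
  have lam_eq: "lam k l = (\<Sum>r<?n + ?m. peval (vec_index (block P i (x k))) (H i $$ (l, r)) * W k r)"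
    if l: "l < ?m" for k l
  proof -
    let ?z = "vec_index (block P i (x k))"
    have W: "W k r = (\<Sum>j<?m. peval ?z (G_mat P i $$ (r, j)) * lam k j)" if r: "r < ?n + ?m" for r
    proof (cases "r < ?n")
      case True
      then show ?thesis
        using stationary[OF True, of k] by (simp add: W_def G_mat_def dg_def)
    next
      case False
      then have "(\<Sum>j<?m. peval ?z (G_mat P i $$ (r, j)) * lam k j) =
          (\<Sum>j<?m. if j = r - ?n then g j (x k) * lam k j else 0)"
        using r by (intro sum.cong) (auto simp: G_mat_def g_def)
      with False r show ?thesis
        by (simp add: W_def)
    qed
    have "(\<Sum>r<?n + ?m. peval ?z (H i $$ (l, r)) * W k r) =
        (\<Sum>r<?n + ?m. \<Sum>j<?m. peval ?z (H i $$ (l, r)) * peval ?z (G_mat P i $$ (r, j)) * lam k j)"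
      by (simp add: W sum_distrib_left mult.assoc)
    also have "\<dots> = (\<Sum>j<?m. (if l = j then 1 else 0) * lam k j)"
      by (subst sum.swap) (simp add: sum_distrib_right[symmetric]
          multiplier_matrix_left_inverse[OF H l])
    also have "\<dots> = (\<Sum>j<?m. if l = j then lam k j else 0)"
      by (rule sum.cong) auto
    finally show ?thesis
      using l by simp
  qed
  have lim_df: "(\<lambda>k. df r (x k)) \<longlonglongrightarrow> df r a" for r
    unfolding df_def by (intro tendsto_intros lim)
  have lim_e: "(\<lambda>k. df r (x k) + 2 * vec_nth (x k - a) w) \<longlonglongrightarrow> df r a" for r w
  proof -
    have "(\<lambda>k. df r (x k) + 2 * vec_nth (x k - a) w) \<longlonglongrightarrow> df r a + 2 * vec_nth (a - a) w"
      by (intro tendsto_intros lim_df lim)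
    then show ?thesis by simp
  qed
  have lim_lam: "(\<lambda>k. lam k l) \<longlonglongrightarrow> multiplier P H i l a" if l: "l < ?m" for l
    unfolding multiplier_eq_sum[OF H l] lam_eq[OF l]
  proof (intro tendsto_intros lim)
    \<comment> \<open>The last \<open>?m\<close> entries tend to 0 by \<open>lim_g_lam\<close>,
      matching the zero padding of \<open>fhat\<close>.\<close>
    fix r assume "r \<in> {..<?n + ?m}"
    then show "(\<lambda>k. W k r) \<longlonglongrightarrow>
        (if r < ?n then peval (vec_nth a) (pdiff (var P i r) (obj P i)) else 0)"
      using lim_e[of r "var P i r"] lim_g_lam[of "r - ?n"] by (auto simp: W_def df_def)
  qed
  have lim_g: "(\<lambda>k. g j (x k)) \<longlonglongrightarrow> g j a" for j
    unfolding g_def by (intro tendsto_intros lim)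
  have lim_dg: "(\<lambda>k. dg r j (x k)) \<longlonglongrightarrow> dg r j a" for r j
    unfolding dg_def by (intro tendsto_intros lim)
  have grad: "df r a - (\<Sum>j<?m. multiplier P H i j a * dg r j a) = 0" if r: "r < ?n" for r
  proof -
    have "(\<lambda>k. \<Sum>j<?m. dg r j (x k) * lam k j) \<longlonglongrightarrow> (\<Sum>j<?m. dg r j a * multiplier P H i j a)"
      by (intro tendsto_intros lim_dg lim_lam) auto
    moreover have "(\<lambda>k. \<Sum>j<?m. dg r j (x k) * lam k j) \<longlonglongrightarrow> df r a"
      unfolding stationary[OF r] by (rule lim_e)
    ultimately have "(\<Sum>j<?m. dg r j a * multiplier P H i j a) = df r a"
      by (rule LIMSEQ_unique)
    then show ?thesis
      by (simp add: mult.commute)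
  qed
  have compl: "multiplier P H i j a * g j a = 0" if j: "j < ?m" for j
    using LIMSEQ_unique[OF tendsto_mult[OF lim_g lim_lam[OF j]] lim_g_lam[OF j]] by (simp add: mult.commute)
  have nonneg: "multiplier P H i j a \<ge> 0" if j: "j \<in> ineqs P i" for j
  proof (rule LIMSEQ_le_const[OF lim_lam])
    show "j < ?m"
      using j con_ix(1) by auto
    have "lam k j \<ge> 0" for k
      using j con_ix(2) c[of k] by (auto simp: lam_def h_def mult_nonneg_nonpos)
    then show "\<exists>N. \<forall>k\<ge>N. 0 \<le> lam k j"
      by blast
  qed
  show "(\<forall>k<?n. peval (vec_nth a) (pdiff (var P i k) (obj P i))
        - (\<Sum>j<?m. multiplier P H i j a * peval (vec_index (block P i a)) (pdiff k (con P i j))) = 0) \<and>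
     (\<forall>j\<in>eqs P i. peval (vec_index (block P i a)) (con P i j) = 0) \<and>
     (\<forall>j\<in>ineqs P i. multiplier P H i j a * peval (vec_index (block P i a)) (con P i j) = 0 \<and>
        peval (vec_index (block P i a)) (con P i j) \<ge> 0 \<and> multiplier P H i j a \<ge> 0)"
    using grad compl nonneg a(1) con_ix(1) by (auto simp: df_def dg_def g_def feasible_def)
qed

section \<open>Generic matrices\<close>

lemma quad_sym_mat:
  "quad (sym_mat t) x =
    (\<Sum>a\<in>UNIV. \<Sum>b\<in>UNIV. vec_nth t (Upair a b) * (vec_nth (homog x) a * vec_nth (homog x) b))"
  by (simp add: quad_def sym_mat_def inner_vec_def matrix_vector_mult_def sum_distrib_left mult_ac)

lemma linear_quad_sym_mat: "linear (\<lambda>t. quad (sym_mat t) x)"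
  unfolding quad_sym_mat
  by (rule linearI) (simp_all add: distrib_right sum.distrib sum_distrib_left mult.assoc)

lemma sum_sum_delta:
  fixes f :: "'a::finite \<Rightarrow> 'b::finite \<Rightarrow> real"
  shows "(\<Sum>a\<in>UNIV. \<Sum>b\<in>UNIV. if a = A \<and> b = B then f a b else 0) = f A B"
proof -
  have "(\<Sum>b\<in>UNIV. if a = A \<and> b = B then f a b else 0) = (if a = A then f a B else 0)" for a
    by (cases "a = A") auto
  then show ?thesis by simp
qed

text \<open>One unordered pair fills two mirrored matrix entries, hence the factor 2. Since the
  leading entry of \<open>homog x\<close> is 1, this matrix reads off a single coordinate of
  \<open>x\<close>.\<close>

lemma quad_sym_mat_axis:
  "quad (sym_mat (axis (Upair None (Some w)) 1)) x = 2 * vec_nth x w"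
proof -
  let ?h = "vec_nth (homog x)"
  have "quad (sym_mat (axis (Upair None (Some w)) 1)) x =
      (\<Sum>a\<in>UNIV. \<Sum>b\<in>UNIV. (if a = None \<and> b = Some w then ?h a * ?h b else 0) +
        (if a = Some w \<and> b = None then ?h a * ?h b else 0))"
    unfolding quad_sym_mat by (intro sum.cong refl) (auto simp: axis_def)
  also have "\<dots> = 2 * vec_nth x w"
    unfolding sum.distrib sum_sum_delta by (simp add: homog_def)
  finally show ?thesis .
qed

text \<open>The difference of the two values is a linear functional of the matrix entries. It is not
  zero, because a coordinate separating \<open>x\<close> from \<open>y\<close> is detected by
  \<open>quad_sym_mat_axis\<close>; so its kernel is a hyperplane.\<close>

lemma negligible_quad_eq:
  fixes x y :: "real ^ 'v::finite"
  assumes "x \<noteq> y"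
  shows "negligible {t. quad (sym_mat t) x = quad (sym_mat t) y}"
proof -
  let ?\<phi> = "\<lambda>t. quad (sym_mat t) x - quad (sym_mat t) y"
  have lin: "linear ?\<phi>"
    by (intro linear_compose_sub linear_quad_sym_mat)
  \<comment> \<open>Represents the functional as an inner product with a fixed vector, the form of a
    hyperplane equation.\<close>
  have adj: "adjoint ?\<phi> 1 \<bullet> t = ?\<phi> t" for t
    using adjoint_works[OF lin, of t 1] by (simp add: inner_commute)
  obtain w where "vec_nth x w \<noteq> vec_nth y w"
    using assms by (auto simp: Finite_Cartesian_Product.vec_eq_iff)
  then have "adjoint ?\<phi> 1 \<bullet> axis (Upair None (Some w)) 1 \<noteq> 0"
    unfolding adj quad_sym_mat_axis by simp
  then have "adjoint ?\<phi> 1 \<noteq> 0"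
    by auto
  then have "negligible {t. adjoint ?\<phi> 1 \<bullet> t = 0}"
    by (intro negligible_hyperplane) auto
  then show ?thesis
    unfolding adj by simp
qed

text \<open>Finitely many pairs of points exclude only a finite union of null sets.\<close>

lemma for_generic_posdef_inj_on_quad:
  fixes G :: "(real ^ 'v::finite) set"
  assumes "finite G"
  shows "for_generic_posdef (\<lambda>\<Theta>. inj_on (quad \<Theta>) G)"
proof -
  have "AE t in lebesgue. \<forall>p\<in>G \<times> G. fst p \<noteq> snd p \<longrightarrow>
      quad (sym_mat t) (fst p) \<noteq> quad (sym_mat t) (snd p)"
  proof (rule AE_finite_allI)
    fix p assume "p \<in> G \<times> G"
    show "AE t in lebesgue. fst p \<noteq> snd p \<longrightarrow> quad (sym_mat t) (fst p) \<noteq> quad (sym_mat t) (snd p)"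
    proof (cases "fst p = snd p")
      case False
      then have "{t. quad (sym_mat t) (fst p) = quad (sym_mat t) (snd p)} \<in> null_sets lebesgue"
        using negligible_quad_eq negligible_iff_null_sets by blast
      from AE_not_in[OF this] show ?thesis
        by simp
    qed simp
  qed (use assms in simp)
  then show ?thesis
    unfolding for_generic_posdef_def by eventually_elim (auto simp: inj_on_def)
qed

section \<open>Cuts\<close>

lemma ex_is_arg_min:
  fixes f :: "'a \<Rightarrow> real"
  assumes "finite {x. Q x}" "Q a"
  shows "\<exists>x. is_arg_min f Q x"
  using ex_is_arg_min_if_finite[of "{x. Q x}" f] assms by auto

lemma ex_is_arg_max:
  fixes f :: "'a \<Rightarrow> real"
  assumes "finite {x. Q x}" "Q a"
  shows "\<exists>x. is_arg_max f Q x"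
  using ex_is_arg_min[OF assms, of "\<lambda>x. - f x"] by (auto simp: is_arg_min_def is_arg_max_def)

lemma finite_image_gap:
  fixes f :: "'a \<Rightarrow> real"
  assumes "finite A"
  obtains c where "c > 0" "\<And>x y. x \<in> A \<Longrightarrow> y \<in> A \<Longrightarrow> f x < f y \<Longrightarrow> f x + c \<le> f y"
proof
  \<comment> \<open>The inserted 1 keeps the set nonempty, hence \<open>Min\<close> meaningful, when
    no two values differ.\<close>
  let ?D = "insert 1 ((\<lambda>(x, y). f y - f x) ` {(x, y) \<in> A \<times> A. f x < f y})"
  have fin: "finite ?D"
    using assms by (auto intro: finite_subset[of _ "A \<times> A"])
  show "Min ?D > 0"
    using fin by (subst Min_gr_iff) auto
  show "f x + Min ?D \<le> f y" if "x \<in> A" "y \<in> A" "f x < f y" for x y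
  proof -
    have "Min ?D \<le> f y - f x"
      using that by (intro Min_le fin) auto
    then show ?thesis by simp
  qed
qed

section \<open>Effect of cuts on equilibria and candidates\<close>

lemma replace_block_self: "is_nep P \<Longrightarrow> replace_block P i (block P i x) x = x"
  by (rule replace_block_eqI) auto

lemma nash_equilibrium_iff:
  assumes "is_nep P"
  shows "nash_equilibrium P x \<longleftrightarrow> (\<forall>i. block P i x \<in> feasible P i \<and>
    (\<forall>y\<in>feasible P i. cost P i x \<le> cost P i (replace_block P i y x)))"
  by (auto simp: nash_equilibrium_def is_arg_min_linorder replace_block_self[OF assms])

lemma kkt_imp_block_feasible: "kkt P H x \<Longrightarrow> block P i x \<in> feasible P i"
  by (auto simp: kkt_def feasible_def)

lemma accepts_imp_nash_equilibrium:
  assumes "is_nep P" "kkt P H u" "accepts P u"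
  shows "nash_equilibrium P u"
  unfolding nash_equilibrium_iff[OF assms(1)]
proof (intro allI conjI ballI)
  fix i y
  show "block P i u \<in> feasible P i"
    by (rule kkt_imp_block_feasible[OF assms(2)])
  assume y: "y \<in> feasible P i"
  obtain z where "L_minimizer P i u z" "L_obj P i u z \<ge> 0"
    using assms(3) unfolding accepts_def L_value_def by metis
  with y have "L_obj P i u y \<ge> 0"
    by (fastforce simp: L_minimizer_def is_arg_min_linorder)
  then show "cost P i u \<le> cost P i (replace_block P i y u)"
    by (simp add: L_obj_def)
qed

text \<open>Cuts come from feasible strategies, and no feasible deviation improves on an
  equilibrium; so no equilibrium is ever cut off.\<close>

lemma nash_equilibrium_U_feasible:
  assumes "is_nep P" "nash_equilibrium P x" "kkt P H x" "\<And>i. K i \<subseteq> feasible P i"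
  shows "U_feasible P H K x"
  using assms by (fastforce simp: U_feasible_def nash_equilibrium_iff)

lemma add_cuts_subset:
  assumes "add_cuts P u K K'"
  shows "K i \<subseteq> K' i \<and> K' i \<subseteq> K i \<union> feasible P i"
proof -
  obtain \<omega> :: "'a \<Rightarrow> real" where "if \<omega> i < 0
      then \<exists>V. finite V \<and> V \<noteq> {} \<and> (\<forall>y\<in>V. L_minimizer P i u y) \<and> K' i = K i \<union> V
      else K' i = K i"
    using assms unfolding add_cuts_def by blast
  then show ?thesis
    by (auto simp: L_minimizer_def is_arg_min_def split: if_splits)
qed

lemma add_cuts_feasible_mono:
  assumes "add_cuts P u K K'" "U_feasible P H K' x"
  shows "U_feasible P H K x"
proof -
  have "K i \<subseteq> K' i" for i
    using add_cuts_subset[OF assms(1)] by simp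
  with assms(2) show ?thesis
    unfolding U_feasible_def by blast
qed

text \<open>Some player with negative minimum contributes a minimizer \<open>y\<close>, and the
  inequality belonging to \<open>y\<close> fails at \<open>u\<close> itself.\<close>

lemma add_cuts_excludes:
  assumes "add_cuts P u K K'"
  shows "\<not> U_feasible P H K' u"
proof -
  obtain \<omega> i where \<omega>: "L_value P i u (\<omega> i)" "\<omega> i < 0" and "if \<omega> i < 0
      then \<exists>V. finite V \<and> V \<noteq> {} \<and> (\<forall>y\<in>V. L_minimizer P i u y) \<and> K' i = K i \<union> V
      else K' i = K i"
    using assms unfolding add_cuts_def by blast
  then obtain V y where V: "\<forall>y\<in>V. L_minimizer P i u y" "K' i = K i \<union> V" "y \<in> V"
    by auto
  then have y: "L_minimizer P i u y"
    by auto
  from \<omega> obtain z where "L_minimizer P i u z" "L_obj P i u z < 0"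
    by (auto simp: L_value_def)
  with y have "L_obj P i u y < 0"
    by (fastforce simp: L_minimizer_def is_arg_min_linorder)
  then have "\<not> cost P i (replace_block P i y u) - cost P i u \<ge> 0"
    by (simp add: L_obj_def)
  moreover have "y \<in> K' i"
    using V by simp
  ultimately show ?thesis
    unfolding U_feasible_def by blast
qed

text \<open>Ensures that a run cannot get stuck at a candidate with solvable subproblems; one
  minimizer per improving player suffices as update.\<close>

lemma L_solvable_imp_accepts_or_add_cuts:
  assumes "L_solvable P u"
  shows "accepts P u \<or> (\<exists>K'. add_cuts P u K K')"
proof -
  obtain y where y: "\<And>i. L_minimizer P i u (y i)"
    using assms unfolding L_solvable_def by metis
  let ?\<omega> = "\<lambda>i. L_obj P i u (y i)"
  have val: "L_value P i u (?\<omega> i)" for i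
    using y by (auto simp: L_value_def)
  show ?thesis
  proof (cases "\<forall>i. ?\<omega> i \<ge> 0")
    case True
    then have "accepts P u"
      unfolding accepts_def by (intro exI[of _ ?\<omega>]) (simp add: val)
    then show ?thesis ..
  next
    case False
    have "add_cuts P u K (\<lambda>i. if ?\<omega> i < 0 then K i \<union> {y i} else K i)"
      unfolding add_cuts_def
    proof (intro exI[of _ ?\<omega>] conjI allI)
      show "\<exists>i. ?\<omega> i < 0"
        using False by (auto simp: not_le)
      show "if ?\<omega> i < 0
          then \<exists>V. finite V \<and> V \<noteq> {} \<and> (\<forall>z\<in>V. L_minimizer P i u z) \<and>
            (if ?\<omega> i < 0 then K i \<union> {y i} else K i) = K i \<union> V
          else (if ?\<omega> i < 0 then K i \<union> {y i} else K i) = K i" for i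
        using y[of i] by (auto intro!: exI[of _ "{y i}"])
    qed (rule val)
    then show ?thesis by blast
  qed
qed

lemma algorithm_A_result:
  assumes "algorithm_A_computes P H \<Theta> K x"
  shows "(\<forall>i. K i \<subseteq> feasible P i) \<and> is_arg_min (quad \<Theta>) (U_feasible P H K) x"
proof -
  \<comment> \<open>Loop invariant of algorithm A: cuts are feasible strategies, and a candidate
    minimizes (U) for the current cuts.\<close>
  define ok where "ok s = (case s of
      A1 K \<Rightarrow> \<forall>i. K i \<subseteq> feasible P i
    | A2 K u \<Rightarrow> (\<forall>i. K i \<subseteq> feasible P i) \<and> is_arg_min (quad \<Theta>) (U_feasible P H K) u
    | A_no_NE \<Rightarrow> True
    | A_NE K u \<Rightarrow> (\<forall>i. K i \<subseteq> feasible P i) \<and> is_arg_min (quad \<Theta>) (U_feasible P H K) u)" for s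
  have "ok s" if "(stepA P H \<Theta>)\<^sup>*\<^sup>* (A1 (\<lambda>_. {})) s" for s
    using that
  proof (induction rule: rtranclp_induct)
    case base
    show ?case by (simp add: ok_def)
  next
    case (step s s')
    from step.hyps(2) step.IH show ?case
    proof (cases rule: stepA.cases)
      case (A_reject u K K')
      with step.IH show ?thesis
        using add_cuts_subset[OF A_reject(3)] by (fastforce simp: ok_def)
    qed (auto simp: ok_def)
  qed
  from this[of "A_NE K x"] assms show ?thesis
    by (simp add: algorithm_A_computes_def ok_def)
qed

section \<open>Termination and completeness of the repeated algorithm B\<close>

text \<open>Finiteness of the KKT set makes optima attained and runs finite; injectivity of
  \<open>quad \<Theta>\<close> keeps two equilibria from sharing a value and one of them from being
  skipped.\<close>

locale separated_nep =
  fixes P :: "('p::finite, 'v::finite) nep"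
    and H :: "'p \<Rightarrow> nat rpoly Matrix.mat"
    and \<Theta> :: "real ^ 'v option ^ 'v option"
  assumes nep: "is_nep P"
    and finite_kkt: "finite {x. kkt P H x}"
    and nash_kkt: "nash_equilibrium P x \<Longrightarrow> kkt P H x"
    and inj_quad: "inj_on (quad \<Theta>) {x. kkt P H x}"
begin

definition below :: "real ^ 'v \<Rightarrow> (real ^ 'v) set" where
  "below x = {y. nash_equilibrium P y \<and> quad \<Theta> y \<le> quad \<Theta> x}"

text \<open>Progress measure across successive applications of algorithm B.\<close>

definition above :: "real ^ 'v \<Rightarrow> nat" where
  "above x = card {y. kkt P H y \<and> quad \<Theta> y > quad \<Theta> x}"

definition num_feasible :: "'p cuts \<Rightarrow> nat" where
  "num_feasible K = card {x. U_feasible P H K x}"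

definition current :: "'p cuts \<Rightarrow> real ^ 'v \<Rightarrow> (real ^ 'v) set \<Rightarrow> bool" where
  "current K x F \<longleftrightarrow> (\<forall>i. K i \<subseteq> feasible P i) \<and> nash_equilibrium P x \<and> F = below x"

text \<open>What step 1 of algorithm B certifies: every feasible value beyond that of
  \<open>x\<close> survives in (U\<open>\<delta>\<close>).\<close>

definition gap :: "'p cuts \<Rightarrow> real ^ 'v \<Rightarrow> real \<Rightarrow> bool" where
  "gap K x \<delta> \<longleftrightarrow>
    (\<forall>y. U_feasible P H K y \<longrightarrow> quad \<Theta> y \<le> quad \<Theta> x \<or> quad \<Theta> x + \<delta> \<le> quad \<Theta> y)"

text \<open>In \<open>B_new_NE\<close> the set is \<open>insert u F\<close>, because the new point
  joins the found ones only at the restart.\<close>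

fun invar :: "(real ^ 'v) set \<times> ('p, 'v) stateB \<Rightarrow> bool" where
  "invar (F, B0 K x) \<longleftrightarrow> current K x F"
| "invar (F, B1 K x \<delta>) \<longleftrightarrow> current K x F \<and> \<delta> > 0"
| "invar (F, B2 K x \<delta>) \<longleftrightarrow> current K x F \<and> \<delta> > 0 \<and> gap K x \<delta>"
| "invar (F, B3 K x \<delta> u) \<longleftrightarrow> current K x F \<and> \<delta> > 0 \<and> gap K x \<delta> \<and>
     is_arg_min (quad \<Theta>) (U\<delta>_feasible P H \<Theta> K x \<delta>) u"
| "invar (F, B_no_more_NE) \<longleftrightarrow> F = {x. nash_equilibrium P x}"
| "invar (F, B_new_NE K u) \<longleftrightarrow> current K u (insert u F)"

section \<open>Preservation of the invariant\<close>

lemma U_feasible_kkt: "U_feasible P H K x \<Longrightarrow> kkt P H x"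
  by (simp add: U_feasible_def)

lemma finite_U_feasible: "finite {x. U_feasible P H K x \<and> Q x}"
  by (rule finite_subset[OF _ finite_kkt]) (auto dest: U_feasible_kkt)

lemma current_U_feasible:
  "current K x F \<Longrightarrow> nash_equilibrium P y \<Longrightarrow> U_feasible P H K y"
  by (intro nash_equilibrium_U_feasible nep nash_kkt) (auto simp: current_def)

lemma current_add_cuts: "current K x F \<Longrightarrow> add_cuts P u K K' \<Longrightarrow> current K' x F"
  using add_cuts_subset[of P u K K'] unfolding current_def by blast

text \<open>Cuts only shrink the feasible set, so the \<delta> found in step 1 stays valid after
  every rejection.\<close>

lemma gap_add_cuts: "gap K x \<delta> \<Longrightarrow> add_cuts P u K K' \<Longrightarrow> gap K' x \<delta>"
  unfolding gap_def by (blast dest: add_cuts_feasible_mono)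

text \<open>\<open>x\<close> minimizes (U), whose feasible set contains all equilibria; by
  injectivity no other equilibrium has a value as small.\<close>

lemma invar_initial:
  assumes "algorithm_A_computes P H \<Theta> K x" "nash_equilibrium P x"
  shows "invar ({x}, B0 K x)"
proof -
  have K: "\<forall>i. K i \<subseteq> feasible P i" and x: "is_arg_min (quad \<Theta>) (U_feasible P H K) x"
    using algorithm_A_result[OF assms(1)] by auto
  have "y = x" if y: "nash_equilibrium P y" "quad \<Theta> y \<le> quad \<Theta> x" for y
  proof -
    have "U_feasible P H K y"
      using nash_equilibrium_U_feasible[OF nep y(1) nash_kkt[OF y(1)]] K by simp
    with x y(2) have "quad \<Theta> y = quad \<Theta> x"
      by (force simp: is_arg_min_linorder)
    then show ?thesis
      using inj_onD[OF inj_quad] nash_kkt y(1) assms(2) by blast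
  qed
  then have "below x = {x}"
    using assms(2) by (auto simp: below_def)
  with K assms(2) show ?thesis
    by (simp add: current_def)
qed

lemma invar_step:
  assumes "stepB P H \<Theta> s s'" "invar (F, s)"
  shows "invar (F, s')"
  using assms(1)
proof (cases rule: stepB.cases)
  case (B_delta_ok K x \<delta> y)
  have "gap K x \<delta>"
    unfolding gap_def
  proof (intro allI impI)
    fix z assume "U_feasible P H K z"
    with B_delta_ok(3,4) show "quad \<Theta> z \<le> quad \<Theta> x \<or> quad \<Theta> x + \<delta> \<le> quad \<Theta> z"
      by (fastforce simp: is_arg_max_linorder M\<delta>_feasible_def)
  qed
  with B_delta_ok(1,2) assms(2) show ?thesis
    by simp
next
  case (B_infeasible K x \<delta>)
  have cur: "current K x F" and g: "gap K x \<delta>"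
    using assms(2) B_infeasible(1) by auto
  \<comment> \<open>An equilibrium with larger value would, by the gap, be feasible for
    (U\<open>\<delta>\<close>).\<close>
  have "quad \<Theta> y \<le> quad \<Theta> x" if "nash_equilibrium P y" for y
    using current_U_feasible[OF cur that] g B_infeasible(3)
    by (auto simp: gap_def U\<delta>_feasible_def)
  with cur B_infeasible(2) show ?thesis
    by (auto simp: current_def below_def)
next
  case (B_accept u K x \<delta>)
  have cur: "current K x F" and \<delta>: "\<delta> > 0" and g: "gap K x \<delta>"
    and u: "is_arg_min (quad \<Theta>) (U\<delta>_feasible P H \<Theta> K x \<delta>) u"
    using assms(2) B_accept(1) by auto
  have u_feas: "U_feasible P H K u" "quad \<Theta> x + \<delta> \<le> quad \<Theta> u"
    using u by (auto simp: is_arg_min_def U\<delta>_feasible_def)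
  have u_nash: "nash_equilibrium P u"
    using accepts_imp_nash_equilibrium[OF nep U_feasible_kkt[OF u_feas(1)] B_accept(3)] .
  \<comment> \<open>The gap makes such a \<open>y\<close> a competitor of \<open>u\<close> in
    (U\<open>\<delta>\<close>), so the two values agree and injectivity identifies the
    points.\<close>
  have "y = u" if y: "nash_equilibrium P y" "quad \<Theta> y \<le> quad \<Theta> u" "\<not> quad \<Theta> y \<le> quad \<Theta> x" for y
  proof -
    have "U_feasible P H K y"
      by (rule current_U_feasible[OF cur y(1)])
    then have "U\<delta>_feasible P H \<Theta> K x \<delta> y"
      using g y(3) by (auto simp: gap_def U\<delta>_feasible_def)
    with u y(2) have "quad \<Theta> y = quad \<Theta> u"
      by (force simp: is_arg_min_linorder)
    then show ?thesis
      using inj_onD[OF inj_quad] nash_kkt y(1) u_nash by blast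
  qed
  then have "insert u (below x) = below u"
    using u_nash u_feas(2) \<delta> by (auto simp: below_def)
  with cur u_nash B_accept(2) show ?thesis
    by (auto simp: current_def)
next
  case (B_reject u K K' x \<delta>)
  then show ?thesis
    using assms(2) current_add_cuts gap_add_cuts by auto
qed (use assms(2) in auto)

lemma invar_rep_step: "stepB_rep P H \<Theta> a b \<Longrightarrow> invar a \<Longrightarrow> invar b"
  by (induction rule: stepB_rep.induct) (auto intro: invar_step)

lemma invar_rep_steps: "(stepB_rep P H \<Theta>)\<^sup>*\<^sup>* a b \<Longrightarrow> invar a \<Longrightarrow> invar b"
  by (induction rule: rtranclp_induct) (auto intro: invar_rep_step)

text \<open>Every other state has a successor. Optimizers exist on finite nonempty feasible sets,
  and the input itself is feasible for (M\<open>\<delta>\<close>), so the maximum is never below its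
  value.\<close>

lemma stuck_imp_no_more_NE:
  assumes "invar (F, s)" "\<nexists>t. stepB_rep P H \<Theta> (F, s) t"
    and "\<And>K x \<delta> u. s = B3 K x \<delta> u \<Longrightarrow> L_solvable P u"
  shows "s = B_no_more_NE"
proof (cases s)
  case (B0 K x)
  then show ?thesis
    using assms(2) rep_step[OF B_start[of 1]] by fastforce
next
  case (B1 K x \<delta>)
  then have "M\<delta>_feasible P H \<Theta> K x \<delta> x"
    using assms(1) current_U_feasible[of K x F x] by (simp add: M\<delta>_feasible_def current_def)
  moreover from this obtain y where y: "is_arg_max (quad \<Theta>) (M\<delta>_feasible P H \<Theta> K x \<delta>) y"
    using ex_is_arg_max[of "M\<delta>_feasible P H \<Theta> K x \<delta>" x "quad \<Theta>"] finite_U_feasible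
    by (auto simp: M\<delta>_feasible_def)
  ultimately have "quad \<Theta> y = quad \<Theta> x \<or> quad \<Theta> y > quad \<Theta> x"
    by (auto simp: is_arg_max_linorder)
  with y B1 assms(2) show ?thesis
    by (blast intro: rep_step B_delta_ok B_delta_shrink)
next
  case (B2 K x \<delta>)
  show ?thesis
  proof (cases "\<exists>y. U\<delta>_feasible P H \<Theta> K x \<delta> y")
    case True
    moreover have "finite {y. U\<delta>_feasible P H \<Theta> K x \<delta> y}"
      unfolding U\<delta>_feasible_def by (rule finite_U_feasible)
    ultimately obtain u where "is_arg_min (quad \<Theta>) (U\<delta>_feasible P H \<Theta> K x \<delta>) u"
      using ex_is_arg_min[of "U\<delta>_feasible P H \<Theta> K x \<delta>" _ "quad \<Theta>"] by blast
    with B2 assms(2) show ?thesis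
      by (blast intro: rep_step B_candidate)
  next
    case False
    with B2 assms(2) show ?thesis
      by (blast intro: rep_step B_infeasible)
  qed
next
  case (B3 K x \<delta> u)
  from L_solvable_imp_accepts_or_add_cuts[OF assms(3)[OF B3], of K] B3 assms(2) show ?thesis
    by (blast intro: rep_step B_accept B_reject)
next
  case (B_new_NE K u)
  with assms(2) show ?thesis
    by (blast intro: rep_restart)
qed

text \<open>The third component decreases while \<open>\<delta>\<close> shrinks, because a shrink step requires \<open>c \<le> \<delta>\<close>
  for the least difference \<open>c\<close> between distinct values of \<open>quad \<Theta>\<close> on the KKT points, and while
  candidates are rejected, because a rejected candidate violates the new cuts.\<close>

fun rank :: "real \<Rightarrow> (real ^ 'v) set \<times> ('p, 'v) stateB \<Rightarrow> nat \<times> nat \<times> nat" where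
  "rank c (F, B0 K x) = (above x, 3, 0)"
| "rank c (F, B1 K x \<delta>) = (above x, 2, nat \<lfloor>\<delta> / c\<rfloor>)"
| "rank c (F, B2 K x \<delta>) = (above x, 1, 2 * num_feasible K + 1)"
| "rank c (F, B3 K x \<delta> u) = (above x, 1, 2 * num_feasible K)"
| "rank c (F, B_no_more_NE) = (0, 0, 0)"
| "rank c (F, B_new_NE K u) = (above u, 4, 0)"

abbreviation rank_order :: "((nat \<times> nat \<times> nat) \<times> (nat \<times> nat \<times> nat)) set" where
  "rank_order \<equiv> less_than <*lex*> less_than <*lex*> less_than"

text \<open>Accepting a new equilibrium lowers the first component, and the second orders the phases
  of one application. The doubling in the third leaves room for both the move to a candidate and the
  return after a rejection.\<close>

lemma rank_step:
  assumes "stepB P H \<Theta> s s'" "invar (F, s)"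
    and c: "c > 0"
    and sep: "\<And>x y. kkt P H x \<Longrightarrow> kkt P H y \<Longrightarrow> quad \<Theta> x < quad \<Theta> y \<Longrightarrow> quad \<Theta> x + c \<le> quad \<Theta> y"
  shows "(rank c (F, s'), rank c (F, s)) \<in> rank_order"
  using assms(1)
proof (cases rule: stepB.cases)
  case (B_delta_shrink K x \<delta> y)
  have "kkt P H x"
    using assms(2) B_delta_shrink(1) by (simp add: current_def nash_kkt)
  moreover have "kkt P H y" "quad \<Theta> y \<le> quad \<Theta> x + \<delta>"
    using B_delta_shrink(3) by (auto simp: is_arg_max_def M\<delta>_feasible_def U_feasible_kkt)
  \<comment> \<open>The maximizer exceeds \<open>x\<close> in value by at least \<open>c\<close> but
    by at most \<delta>. So the floor of \<open>\<delta> / c\<close> is positive, and division by 5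
    lowers it strictly.\<close>
  ultimately have "c \<le> \<delta>"
    using sep[of x y] B_delta_shrink(4) by simp
  then have "1 \<le> \<delta> / c"
    using c by simp
  then have pos: "0 < \<lfloor>\<delta> / c\<rfloor>" and ge1: "1 \<le> real_of_int \<lfloor>\<delta> / c\<rfloor>"
    by simp_all
  have floor_div: "real_of_int \<lfloor>q / 5\<rfloor> < real_of_int \<lfloor>q\<rfloor>" if "1 \<le> real_of_int \<lfloor>q\<rfloor>" for q :: real
  proof -
    have "q < real_of_int \<lfloor>q\<rfloor> + 1" "real_of_int \<lfloor>q / 5\<rfloor> \<le> q / 5"
      by (linarith, rule of_int_floor_le)
    with that show ?thesis
      by linarith
  qed
  have "real_of_int \<lfloor>\<delta> / c / 5\<rfloor> < real_of_int \<lfloor>\<delta> / c\<rfloor>"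
    by (rule floor_div[OF ge1])
  then have "\<lfloor>\<delta> / c / 5\<rfloor> < \<lfloor>\<delta> / c\<rfloor>"
    by (simp only: of_int_less_iff)
  moreover have "\<delta> / c / 5 = \<delta> / 5 / c"
    by simp
  ultimately have "\<lfloor>\<delta> / 5 / c\<rfloor> < \<lfloor>\<delta> / c\<rfloor>"
    by (simp only:)
  with pos B_delta_shrink(1,2) show ?thesis
    by simp
next
  case (B_accept u K x \<delta>)
  have u: "kkt P H u" "quad \<Theta> x < quad \<Theta> u"
    using assms(2) B_accept(1) by (auto simp: is_arg_min_def U\<delta>_feasible_def U_feasible_kkt)
  have "{y. kkt P H y \<and> quad \<Theta> y > quad \<Theta> u} \<subset> {y. kkt P H y \<and> quad \<Theta> y > quad \<Theta> x}"
    using u by (intro psubsetI) auto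
  then have "above u < above x"
    unfolding above_def
    by (intro psubset_card_mono finite_subset[OF _ finite_kkt]) auto
  with B_accept(1,2) show ?thesis
    by simp
next
  case (B_reject u K K' x \<delta>)
  have u: "U_feasible P H K u"
    using assms(2) B_reject(1) by (auto simp: is_arg_min_def U\<delta>_feasible_def)
  have "{y. U_feasible P H K' y} \<subset> {y. U_feasible P H K y}"
    using u add_cuts_excludes[OF B_reject(3)] add_cuts_feasible_mono[OF B_reject(3)] by blast
  then have "num_feasible K' < num_feasible K"
    unfolding num_feasible_def using finite_U_feasible[of K "\<lambda>_. True"]
    by (intro psubset_card_mono) auto
  with B_reject(1,2) show ?thesis
    by simp
qed auto

text \<open>A single constant \<open>c\<close> serves the whole run, since the finite set of KKT
  points never changes.\<close>

lemma no_infinite_run: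
  assumes "invar (\<sigma> 0)" "\<And>k. stepB_rep P H \<Theta> (\<sigma> k) (\<sigma> (Suc k))"
  shows False
proof -
  obtain c where c: "c > 0"
    "\<And>x y. x \<in> {x. kkt P H x} \<Longrightarrow> y \<in> {x. kkt P H x} \<Longrightarrow> quad \<Theta> x < quad \<Theta> y \<Longrightarrow> quad \<Theta> x + c \<le> quad \<Theta> y"
    using finite_image_gap[OF finite_kkt] by blast
  have inv: "invar (\<sigma> k)" for k
    by (induction k) (use assms invar_rep_step in blast)+
  have "(rank c (\<sigma> (Suc k)), rank c (\<sigma> k)) \<in> rank_order" for k
    using assms(2)[of k]
  proof (cases rule: stepB_rep.cases)
    case (rep_step s s' F)
    have "(rank c (F, s'), rank c (F, s)) \<in> rank_order"
      using inv[of k] rep_step(1) c(2)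
      by (intro rank_step[OF rep_step(3) _ c(1)]) simp_all
    then show ?thesis
      unfolding rep_step(1,2) .
  qed auto
  moreover have "wf rank_order"
    by (intro wf_lex_prod wf_less_than)
  ultimately show False
    unfolding wf_iff_no_infinite_down_chain by (meson comp_apply)
qed

lemma repeated_B_finds_all:
  assumes "algorithm_A_computes P H \<Theta> K x" "nash_equilibrium P x"
  shows "repeated_B_finds_all P H \<Theta> K x"
  unfolding repeated_B_finds_all_def
proof (intro conjI allI impI)
  note init = invar_initial[OF assms]
  show "\<nexists>\<sigma>. \<sigma> 0 = ({x}, B0 K x) \<and> (\<forall>k::nat. stepB_rep P H \<Theta> (\<sigma> k) (\<sigma> (Suc k)))"
    using no_infinite_run init by metis
  fix F s
  assume run: "(stepB_rep P H \<Theta>)\<^sup>*\<^sup>* ({x}, B0 K x) (F, s)"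
    and stuck: "\<nexists>t. stepB_rep P H \<Theta> (F, s) t"
    and solv: "\<forall>K' x \<delta> u. s = B3 K' x \<delta> u \<longrightarrow> L_solvable P u"
  have inv: "invar (F, s)"
    by (rule invar_rep_steps[OF run init])
  show s: "s = B_no_more_NE"
    using stuck_imp_no_more_NE[OF inv stuck] solv by blast
  show "F = {x. nash_equilibrium P x}"
    using inv unfolding s by simp
qed

end

theorem corollary3p9:
  fixes P :: "('p::finite, 'v::finite) nep"
    and H :: "'p \<Rightarrow> nat rpoly Matrix.mat"
  assumes "is_nep P"
    and "\<And>i. nonsingular P i"
    and "multiplier_matrices P H"
    and "finite ({x. kkt P H x} - {x. nash_equilibrium P x})"
    and "finite {x. nash_equilibrium P x}"
  shows "for_generic_posdef (\<lambda>\<Theta>. \<forall>K xs.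
           algorithm_A_computes P H \<Theta> K xs \<longrightarrow>
           nash_equilibrium P xs \<longrightarrow>
           xs isolated_in {x. kkt P H x} \<longrightarrow>
           repeated_B_finds_all P H \<Theta> K xs)"
proof -
  have fin: "finite {x. kkt P H x}"
    using finite_UnI[OF assms(4,5)] by (rule finite_subset[rotated]) auto
  \<comment> \<open>Injectivity alone handles all \<open>K\<close> and \<open>xs\<close> at once, so
    one null set of matrices is excluded for all outcomes of algorithm A.\<close>
  have "repeated_B_finds_all P H \<Theta> K xs"
    if "inj_on (quad \<Theta>) {x. kkt P H x}" "algorithm_A_computes P H \<Theta> K xs" "nash_equilibrium P xs"
    for \<Theta> K xs
  proof -
    interpret separated_nep P H \<Theta>
      using assms(1) fin nash_equilibrium_imp_kkt[OF assms(1,3)] that(1) by unfold_locales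
    show ?thesis
      by (rule repeated_B_finds_all[OF that(2,3)])
  qed
  then show ?thesis
    using for_generic_posdef_inj_on_quad[OF fin] unfolding for_generic_posdef_def
    by (auto elim: eventually_mono)
qed

end
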